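(* Let $\|\cdot\|$ be a strictly convex norm on $\mathbb R^2$ that is $C^1$ on $\mathbb R^2\setminus\{0\}$. There exists a constant $C_0>0$ depending only on $\mathsf B$ such that \[C_0^{-1}\mathrm c^{1D}(z^+,z^-)\le\mathrm c^{\mathrm{ENT}}(z^+,z^-)\le C_0\,\mathrm c^{1D}(z^+,z^-)\] for all distinct $z^+,z^-\in\partial\mathsf B$.
   Context: $\mathsf B=\{\|z\|<1\}$, normalized so $\partial\mathsf B$ has length $2\pi$; $\gamma:\mathbb R/2\pi\mathbb Z\to\partial\mathsf B$ is the counterclockwise arc-length parametrization; $\mathbb R^2\cong\mathbb C$ and $i$ is rotation by $\pi/2$. For distinct $z^\pm\in\partial\mathsf B$ set $\nu=i\frac{z^+-z^-}{|z^+-z^-|}$ and $a=z^+\cdot\nu=z^-\cdot\nu$. Define \[\mathrm c^{1D}(z^+,z^-)=2\Big|\int_{z^-\cdot i\nu}^{z^+\cdot i\nu}\big(1-\|a\nu+s\,i\nu\|^2\big)\,ds\Big|,\] \[\mathrm c^{\mathrm{ENT}}(z^+,z^-)=\sup_{\lambda\in\Lambda_*}\int_{\theta^-}^{\theta^+}\lambda(t)\,\gamma'(t)\cdot\nu\,dt\quad\text{where }z^\pm=\gamma(\theta^\pm),\] with $\Lambda_*=\{\lambda\in C^1(\mathbb R/2\pi\mathbb Z):\int_{\mathbb R/2\pi\mathbb Z}\lambda\gamma'\,dt=0,\ \|\lambda'\|_\infty\le1\}$ (the integral does not depend on the choice of $\theta^\pm$ modulo $2\pi$). *)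

theory Defs
  imports "HOL-Complex_Analysis.Complex_Analysis"
begin

text \<open>The plane R^2 is identified with the complex numbers; the dot product is the
  real inner product on complex, and multiplication by the imaginary unit is
  rotation by pi/2.\<close>

definition is_norm :: "(complex \<Rightarrow> real) \<Rightarrow> bool" where
  "is_norm N \<longleftrightarrow>
     (\<forall>x y. N (x + y) \<le> N x + N y) \<and>
     (\<forall>(c::real) x. N (of_real c * x) = \<bar>c\<bar> * N x) \<and>
     (\<forall>x. N x = 0 \<longleftrightarrow> x = 0)"

definition strictly_convex_norm :: "(complex \<Rightarrow> real) \<Rightarrow> bool" where
  "strictly_convex_norm N \<longleftrightarrow>
     (\<forall>x y. N x = 1 \<longrightarrow> N y = 1 \<longrightarrow> x \<noteq> y \<longrightarrow> N ((x + y) / 2) < 1)"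

definition C1_away_from_0 :: "(complex \<Rightarrow> real) \<Rightarrow> bool" where
  "C1_away_from_0 N \<longleftrightarrow>
     (\<exists>g :: complex \<Rightarrow> complex. continuous_on (UNIV - {0}) g \<and>
        (\<forall>x. x \<noteq> 0 \<longrightarrow> (N has_derivative (\<lambda>h. inner (g x) h)) (at x)))"

text \<open>gamma is the counterclockwise (Euclidean) arc-length parametrization of the
  boundary of the unit ball of N, of period 2 pi (this encodes the normalization
  that the boundary has length 2 pi).\<close>
definition ccw_arclength_param :: "(complex \<Rightarrow> real) \<Rightarrow> (real \<Rightarrow> complex) \<Rightarrow> bool" where
  "ccw_arclength_param N \<gamma> \<longleftrightarrow>
     (\<forall>t. \<gamma> (t + 2 * pi) = \<gamma> t) \<and>
     inj_on \<gamma> {0..<2 * pi} \<and>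
     \<gamma> ` UNIV = {z. N z = 1} \<and>
     (\<forall>t. \<gamma> differentiable (at t) \<and> norm (vector_derivative \<gamma> (at t)) = 1) \<and>
     winding_number (\<lambda>s. \<gamma> (2 * pi * s)) 0 = 1"

definition oint :: "real \<Rightarrow> real \<Rightarrow> (real \<Rightarrow> real) \<Rightarrow> real" where
  "oint a b f = (if a \<le> b then integral {a..b} f else - integral {b..a} f)"

definition Lambda_star :: "(real \<Rightarrow> complex) \<Rightarrow> (real \<Rightarrow> real) set" where
  "Lambda_star \<gamma> = {l.
     (\<forall>t. l (t + 2 * pi) = l t) \<and>
     (\<exists>l'. continuous_on UNIV l' \<and> (\<forall>t. (l has_real_derivative l' t) (at t)) \<and>
           (\<forall>t. \<bar>l' t\<bar> \<le> 1)) \<and>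
     integral {0..2 * pi} (\<lambda>t. of_real (l t) * vector_derivative \<gamma> (at t)) = 0}"

definition nu_vec :: "complex \<Rightarrow> complex \<Rightarrow> complex" where
  "nu_vec zp zm = \<i> * (zp - zm) / of_real (cmod (zp - zm))"

definition param_of :: "(real \<Rightarrow> complex) \<Rightarrow> complex \<Rightarrow> real" where
  "param_of \<gamma> z = (SOME \<theta>. \<theta> \<in> {0..<2 * pi} \<and> \<gamma> \<theta> = z)"

definition c1D :: "(complex \<Rightarrow> real) \<Rightarrow> complex \<Rightarrow> complex \<Rightarrow> real" where
  "c1D N zp zm =
     (let \<nu> = nu_vec zp zm; a = inner zp \<nu> in
      2 * \<bar>oint (inner zm (\<i> * \<nu>)) (inner zp (\<i> * \<nu>))
              (\<lambda>s. 1 - (N (of_real a * \<nu> + of_real s * (\<i> * \<nu>)))\<^sup>2)\<bar>)"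

definition cENT :: "(complex \<Rightarrow> real) \<Rightarrow> (real \<Rightarrow> complex) \<Rightarrow> complex \<Rightarrow> complex \<Rightarrow> real" where
  "cENT N \<gamma> zp zm =
     (let \<nu> = nu_vec zp zm in
      Sup ((\<lambda>l. oint (param_of \<gamma> zm) (param_of \<gamma> zp)
                   (\<lambda>t. l t * inner (vector_derivative \<gamma> (at t)) \<nu>)) ` Lambda_star \<gamma>))"

end

theory Submission
  imports Defs
begin

text \<open>Integrating by parts, \<open>cENT\<close> is the supremum of \<open>\<integral>\<^sub>I f h\<close> over periodic \<open>f = \<lambda>'\<close> with \<open>\<bar>f\<bar> \<le> 1\<close> and
  \<open>\<integral> f = 0\<close>, \<open>\<integral> f \<gamma> = 0\<close>, where \<open>I\<close> is the arc cut off by the chord on the side away from the origin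
  and \<open>h\<close> is its height above the chord. This is at most the area-like quantity \<open>\<integral>\<^sub>I h\<close>, and at least a
  constant fraction of it: an approximate indicator of \<open>I\<close> can be corrected to satisfy the moment
  conditions by a bounded function supported outside \<open>I\<close>, since the complement of \<open>I\<close> has length
  bounded below and \<open>1, \<gamma>\<^sub>1, \<gamma>\<^sub>2\<close> are linearly independent on every arc. Finally \<open>\<integral>\<^sub>I h\<close> is comparable
  to \<open>c1D\<close>: if the chord stays away from the origin, central projection of \<open>I\<close> onto it gives an explicit
  change of variables; if not, both quantities are bounded above and below.\<close>

subsection \<open>Real functions and complex frames\<close>

text \<open>Two features of the setting shape the argument. First, \<open>\<gamma>'\<close> is only
  a pointwise derivative of length 1, with no continuity at hand: integration by parts and
  substitution rely on gauge integrals, which integrate every derivative, and the sign of the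
  projection density comes from the Darboux property. What replaces continuity is transversality:
  the determinant of \<open>\<gamma>\<close> and \<open>\<gamma>'\<close> is at least
  \<open>1 / K\<close> in absolute value, by Euler's identity for the gradient of \<open>N\<close>.
  Second, the constants must not depend on the chord. They are built from \<open>K\<close> and
  \<open>R\<close>, the bounds of \<open>N\<close> against the Euclidean norm, and from one bound
  for inverting the moment operator, uniform because finitely many arcs suffice. A test function
  must be continuous, so the indicator of the cap becomes \<open>h / (h + \<epsilon>)\<close>, which
  costs at most \<open>\<epsilon>\<close> per unit length. Reversing the chord flips
  \<open>\<nu>\<close> and changes neither cost, so \<open>a \<ge> 0\<close> may be assumed; this is
  what keeps the complement of the cap long.\<close>

lemma derivative_nonzero_imp_signed:
  fixes f f' :: "real \<Rightarrow> real"
  assumes der: "\<And>x. x \<in> {a..b} \<Longrightarrow> (f has_real_derivative f' x) (at x)"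
    and nz: "\<And>x. x \<in> {a..b} \<Longrightarrow> f' x \<noteq> 0"
  shows "(\<forall>x\<in>{a<..<b}. f' x > 0) \<or> (\<forall>x\<in>{a<..<b}. f' x < 0)"
proof -
  \<comment> \<open>Darboux's argument: by the mean value theorem \<open>f\<close> is injective,
    hence monotone by continuity, and a monotone function admits only one sign of the
    derivative.\<close>
  have inj: "inj_on f {a..b}"
  proof (rule linorder_inj_onI)
    fix x y assume xy: "x < y" "x \<in> {a..b}" "y \<in> {a..b}"
    then obtain z where "z > x" "z < y" "f y - f x = (y - x) * f' z"
      using MVT2[of x y f f'] der by auto
    with xy nz[of z] show "f x \<noteq> f y" by auto
  qed auto
  have cont: "continuous_on {a..b} f"
    using der by (intro continuous_at_imp_continuous_on ballI DERIV_isCont)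
  consider "strict_mono_on {a..b} f" | "strict_antimono_on {a..b} f"
    using injective_eq_monotone_map[of "{a..b}" f] inj cont by (auto simp: is_interval_cc)
  then show ?thesis
  proof cases
    case 1
    have "f' x > 0" if x: "x \<in> {a<..<b}" for x
    proof -
      have "\<not> f' x < 0"
      proof
        assume "f' x < 0"
        then obtain d where d: "d > 0" "\<And>h. h > 0 \<Longrightarrow> h < d \<Longrightarrow> f (x + h) < f x"
          using DERIV_neg_dec_right[of f "f' x" x] der[of x] x by auto
        define h where "h = min (d/2) ((b - x)/2)"
        have h: "h > 0" "h < d" "x + h \<in> {a..b}" using d x by (auto simp: h_def min_def field_simps)
        have "f x < f (x + h)" using 1 h x by (auto simp: strict_mono_on_def)
        with d(2)[of h] h show False by simp
      qed
      with nz[of x] x show ?thesis by force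
    qed
    then show ?thesis by blast
  next
    case 2
    have "f' x < 0" if x: "x \<in> {a<..<b}" for x
    proof -
      have "\<not> f' x > 0"
      proof
        assume "f' x > 0"
        then obtain d where d: "d > 0" "\<And>h. h > 0 \<Longrightarrow> h < d \<Longrightarrow> f x < f (x + h)"
          using DERIV_pos_inc_right[of f "f' x" x] der[of x] x by auto
        define h where "h = min (d/2) ((b - x)/2)"
        have h: "h > 0" "h < d" "x + h \<in> {a..b}" using d x by (auto simp: h_def min_def field_simps)
        have "f (x + h) < f x" using 2 h x by (auto simp: monotone_on_def)
        with d(2)[of h] h show False by simp
      qed
      with nz[of x] x show ?thesis by force
    qed
    then show ?thesis by blast
  qed
qed

lemma continuous_antiderivative:
  fixes f :: "real \<Rightarrow> 'a :: euclidean_space"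
  assumes "continuous_on UNIV f"
  obtains F where "\<And>x. (F has_vector_derivative f x) (at x)"
proof -
  have "isCont f x" for x
    using assms by (simp add: continuous_on_eq_continuous_at)
  then obtain F where "\<forall>x::real. -\<infinity> < ereal x \<longrightarrow> ereal x < \<infinity> \<longrightarrow> (F has_vector_derivative f x) (at x)"
    using einterval_antiderivative[of "-\<infinity>" "\<infinity>" f] by auto
  then show thesis by (intro that[of F]) simp
qed

lemma integral_periodic_shift:
  fixes f :: "real \<Rightarrow> 'a :: euclidean_space"
  assumes cont: "continuous_on UNIV f" and per: "\<And>t. f (t + p) = f t" and "p \<ge> 0"
  shows "integral {c..c + p} f = integral {0..p} f"
proof -
  obtain F where F: "\<And>x. (F has_vector_derivative f x) (at x)"
    using continuous_antiderivative[OF cont] by blast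
  have int: "integral {a..a + p} f = F (a + p) - F a" for a
    using \<open>p \<ge> 0\<close> F by (intro integral_unique fundamental_theorem_of_calculus)
      (auto intro: has_vector_derivative_at_within)
  \<comment> \<open>By periodicity this derivative vanishes, so the increment of a primitive over
    one period does not depend on the starting point.\<close>
  have "((\<lambda>x. F (x + p) - F x) has_vector_derivative f (x + p) - f x) (at x)" for x
  proof -
    have "((F \<circ> (\<lambda>x. x + p)) has_vector_derivative 1 *\<^sub>R f (x + p)) (at x)"
      by (rule vector_diff_chain_at) (auto intro!: derivative_eq_intros F)
    then show ?thesis by (auto intro!: derivative_eq_intros F simp: o_def)
  qed
  then have "((\<lambda>x. F (x + p) - F x) has_vector_derivative 0) (at x within UNIV)" for x
    by (simp add: per)
  then obtain k where k: "\<And>x. F (x + p) - F x = k"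
    using has_vector_derivative_zero_constant[of UNIV "\<lambda>x. F (x + p) - F x"] by auto
  then show ?thesis using int[of c] int[of 0] k[of c] k[of 0] by simp
qed

text \<open>Serves to show that \<open>bump\<close> vanishes at distance at least
  \<open>\<rho>\<close> from its centre modulo \<open>2\<pi>\<close>.\<close>

lemma cos_le_cos_of_mem:
  assumes "0 \<le> \<rho>" "\<rho> \<le> pi" "\<rho> \<le> x" "x \<le> 2 * pi - \<rho>"
  shows "cos x \<le> cos \<rho>"
proof (cases "x \<le> pi")
  case True
  then show ?thesis using assms by (intro cos_monotone_0_pi_le) auto
next
  case False
  have "cos x = cos (2 * pi - x)" by simp
  also have "\<dots> \<le> cos \<rho>" using assms False by (intro cos_monotone_0_pi_le) auto
  finally show ?thesis .
qed

lemma complex_eq_by_frame: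
  assumes "cmod \<nu> = 1"
  shows "x = of_real (inner x \<nu>) * \<nu> + of_real (inner x (\<i> * \<nu>)) * (\<i> * \<nu>)"
proof -
  have 1: "(Re \<nu>)\<^sup>2 + (Im \<nu>)\<^sup>2 = 1" using assms by (simp add: cmod_def)
  have "Re x = Re x * ((Re \<nu>)\<^sup>2 + (Im \<nu>)\<^sup>2)" "Im x = Im x * ((Re \<nu>)\<^sup>2 + (Im \<nu>)\<^sup>2)"
    using 1 by auto
  then show ?thesis
    by (simp add: complex_eq_iff inner_complex_def algebra_simps power2_eq_square)
qed

text \<open>Both sides are the determinant of \<open>x\<close> and \<open>y\<close>, because
  \<open>\<nu>\<close>, \<open>\<i> * \<nu>\<close> is a positively oriented orthonormal
  basis.\<close>

lemma det_frame:
  assumes "cmod \<nu> = 1"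
  shows "inner x \<nu> * inner y (\<i> * \<nu>) - inner x (\<i> * \<nu>) * inner y \<nu> = Im (cnj x * y)"
proof -
  have "inner x \<nu> * inner y (\<i> * \<nu>) - inner x (\<i> * \<nu>) * inner y \<nu>
      = Im (cnj x * y) * ((Re \<nu>)\<^sup>2 + (Im \<nu>)\<^sup>2)"
    by (simp add: inner_complex_def algebra_simps power2_eq_square)
  then show ?thesis using assms by (simp add: cmod_def)
qed

section \<open>Exchanging the two endpoints of a chord\<close>

lemma oint_swap: "oint b a f = - oint a b f"
  by (cases a b rule: linorder_cases) (auto simp: oint_def)

lemma oint_reflect: "oint (- b) (- a) (\<lambda>s. f (- s)) = oint a b f"
proof (cases "a \<le> b")
  case True
  then show ?thesis by (simp add: oint_def)
next
  case False
  then have "oint (- b) (- a) (\<lambda>s. f (- s)) = - integral {- a..- b} (\<lambda>s. f (- s))"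
    by (simp add: oint_def)
  also have "integral {- a..- b} (\<lambda>s. f (- s)) = integral {b..a} f"
    by (rule Henstock_Kurzweil_Integration.integral_reflect_real)
  finally show ?thesis using False by (simp add: oint_def)
qed

lemma nu_vec_swap: "nu_vec zm zp = - nu_vec zp zm"
  by (simp add: nu_vec_def norm_minus_commute flip: minus_divide_left) (simp add: algebra_simps diff_divide_distrib)

lemma inner_nu_vec: "inner zp (nu_vec zp zm) = inner zm (nu_vec zp zm)"
proof -
  have "inner (zp - zm) (nu_vec zp zm) = 0"
    by (simp add: nu_vec_def inner_complex_def)
      (simp add: algebra_simps add_divide_distrib diff_divide_distrib)
  then show ?thesis by (simp add: inner_diff_left)
qed

lemma norm_nu_vec: "zp \<noteq> zm \<Longrightarrow> cmod (nu_vec zp zm) = 1"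
  by (simp add: nu_vec_def norm_divide norm_mult)

lemma inner_nu_vec_less:
  assumes "zp \<noteq> zm"
  shows "inner zp (\<i> * nu_vec zp zm) < inner zm (\<i> * nu_vec zp zm)"
proof -
  have "\<i> * nu_vec zp zm = - ((zp - zm) /\<^sub>R cmod (zp - zm))"
    by (simp add: nu_vec_def scaleR_conv_of_real divide_inverse mult.commute algebra_simps)
  then have "inner (zp - zm) (\<i> * nu_vec zp zm) = - (inner (zp - zm) (zp - zm) / cmod (zp - zm))"
    by (simp add: divide_inverse mult.commute)
  also have "\<dots> < 0" using assms by simp
  finally show ?thesis by (simp add: inner_diff_left)
qed

text \<open>Two sign changes cancel: that of \<open>\<nu>\<close> and that of the direction of
  integration.\<close>

lemma cENT_swap: "cENT N \<gamma> zm zp = cENT N \<gamma> zp zm"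
  unfolding cENT_def Let_def nu_vec_swap[of zm zp] oint_swap[of "param_of \<gamma> zp"]
  by (simp add: oint_def)

text \<open>Reversing \<open>\<nu>\<close> replaces \<open>a\<close> by \<open>- a\<close> and the
  coordinate \<open>s\<close> by \<open>- s\<close>, which describes the same points of the
  chord.\<close>

lemma c1D_swap: "c1D N zm zp = c1D N zp zm"
proof -
  let ?\<nu> = "nu_vec zp zm"
  let ?F = "\<lambda>s. 1 - (N (of_real (inner zp ?\<nu>) * ?\<nu> + of_real s * (\<i> * ?\<nu>)))\<^sup>2"
  have "c1D N zm zp = 2 * \<bar>oint (- inner zp (\<i> * ?\<nu>)) (- inner zm (\<i> * ?\<nu>)) (\<lambda>s. ?F (- s))\<bar>"
    by (simp add: c1D_def Let_def nu_vec_swap[of zm zp] inner_nu_vec)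
  also have "\<dots> = 2 * \<bar>oint (inner zm (\<i> * ?\<nu>)) (inner zp (\<i> * ?\<nu>)) ?F\<bar>"
    by (subst oint_reflect) simp
  finally show ?thesis by (simp add: c1D_def Let_def)
qed

subsection \<open>Parametrized strictly convex curves\<close>

text \<open>Gathers all that the comparison uses of the norm and the curve. \<open>K\<close> and
  \<open>R\<close> compare \<open>N\<close> with the Euclidean norm; the assumption
  \<open>det\<close> says that the curve crosses the rays from the origin transversally.\<close>

locale strictly_convex_curve =
  fixes N :: "complex \<Rightarrow> real" and \<gamma> \<gamma>' :: "real \<Rightarrow> complex" and K R :: real
  assumes triangle: "N (x + y) \<le> N x + N y"
    and homogeneous: "N (of_real c * x) = \<bar>c\<bar> * N x"
    and strict: "N x = 1 \<Longrightarrow> N y = 1 \<Longrightarrow> x \<noteq> y \<Longrightarrow> N ((x + y) / 2) < 1"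
    and K: "K \<ge> 1" and N_le: "N x \<le> K * cmod x"
    and R: "R \<ge> 1" and N_ge: "cmod x \<le> R * N x"
    and periodic: "\<gamma> (t + 2 * pi) = \<gamma> t"
    and inj: "inj_on \<gamma> {0..<2 * pi}"
    and range: "range \<gamma> = {z. N z = 1}"
    and deriv: "(\<gamma> has_vector_derivative \<gamma>' t) (at t)"
    and speed: "cmod (\<gamma>' t) = 1"
    and det: "\<bar>Im (cnj (\<gamma> t) * \<gamma>' t)\<bar> \<ge> 1 / K"
begin

lemma N_nonneg: "N x \<ge> 0"
proof -
  have "0 \<le> R * N x" using N_ge[of x] norm_ge_zero[of x] by linarith
  then show ?thesis using R by (simp add: zero_le_mult_iff)
qed

lemma N_pos: "x \<noteq> 0 \<Longrightarrow> N x > 0"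
  using N_ge[of x] N_nonneg[of x] by (cases "N x = 0") auto

lemma N_curve [simp]: "N (\<gamma> t) = 1"
  using range by auto

lemma norm_curve_le: "cmod (\<gamma> t) \<le> R"
  using N_ge[of "\<gamma> t"] by simp

lemma N_diff_le: "N x \<le> N y + K * cmod (x - y)"
  using triangle[of y "x - y"] N_le[of "x - y"] by simp

lemma N_continuous: "continuous_on S N"
proof (rule lipschitz_on_continuous_on)
  show "K-lipschitz_on S N"
  proof (rule lipschitz_onI)
    show "dist (N x) (N y) \<le> K * dist x y" for x y
      using N_diff_le[of x y] N_diff_le[of y x]
      by (auto simp: dist_norm norm_minus_commute abs_if)
  qed (use K in simp)
qed

text \<open>Up to \<open>\<tau> = 1/2\<close> the point is a convex combination of \<open>x\<close>
  and the midpoint, with positive weight \<open>2 * \<tau>\<close> on the latter; the other half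
  follows by exchanging \<open>x\<close> and \<open>y\<close>.\<close>

lemma N_between:
  assumes "N x = 1" "N y = 1" "x \<noteq> y" "0 < \<tau>" "\<tau> < 1"
  shows "N (of_real (1 - \<tau>) * x + of_real \<tau> * y) < 1"
proof -
  have half: "N (of_real (1 - \<tau>) * x + of_real \<tau> * y) < 1"
    if "N x = 1" "N y = 1" "x \<noteq> y" "0 < \<tau>" "\<tau> \<le> 1/2" for x y \<tau>
  proof -
    have "of_real (1 - \<tau>) * x + of_real \<tau> * y
        = of_real (1 - 2 * \<tau>) * x + of_real (2 * \<tau>) * ((x + y) / 2)"
      by (simp add: algebra_simps)
    then have "N (of_real (1 - \<tau>) * x + of_real \<tau> * y)
        \<le> (1 - 2 * \<tau>) + 2 * \<tau> * N ((x + y) / 2)"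
      using triangle[of "of_real (1 - 2 * \<tau>) * x" "of_real (2 * \<tau>) * ((x + y) / 2)"] that
        homogeneous[of "1 - 2 * \<tau>" x] homogeneous[of "2 * \<tau>" "(x + y) / 2"] by simp
    also have "\<dots> < (1 - 2 * \<tau>) + 2 * \<tau> * 1"
      using strict[of x y] that by (intro add_strict_left_mono mult_strict_left_mono) auto
    finally show ?thesis by simp
  qed
  show ?thesis
  proof (cases "\<tau> \<le> 1/2")
    case True
    then show ?thesis using half assms by blast
  next
    case False
    then show ?thesis using half[of y x "1 - \<tau>"] assms by (simp add: add.commute)
  qed
qed

text \<open>The middle one of the three points would lie strictly inside the ball. The coordinate
  along \<open>\<i> * e\<close> decides which one is in the middle.\<close>

lemma no_three_collinear:
  assumes N: "N x = 1" "N y = 1" "N z = 1" and ne: "x \<noteq> y" "y \<noteq> z" "x \<noteq> z"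
    and e: "cmod e = 1" "inner x e = a" "inner y e = a" "inner z e = a"
  shows False
proof -
  have ordered: False if N: "N x = 1" "N y = 1" "N z = 1"
    and a: "inner x e = a" "inner y e = a" "inner z e = a"
    and less: "inner x (\<i> * e) < inner y (\<i> * e)" "inner y (\<i> * e) < inner z (\<i> * e)" for x y z
  proof -
    define s where "s = (\<lambda>w. inner w (\<i> * e))"
    define \<tau> where "\<tau> = (s y - s x) / (s z - s x)"
    have \<tau>: "0 < \<tau>" "\<tau> < 1" using less by (auto simp: \<tau>_def s_def)
    have fr: "x = of_real a * e + of_real (s x) * (\<i> * e)" "y = of_real a * e + of_real (s y) * (\<i> * e)"
      "z = of_real a * e + of_real (s z) * (\<i> * e)"
      using complex_eq_by_frame[OF e(1)] a s_def by metis+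
    have "\<tau> * (s z - s x) = s y - s x" using less by (simp add: \<tau>_def s_def)
    then have sy: "s y = (1 - \<tau>) * s x + \<tau> * s z" by (simp add: algebra_simps)
    have "of_real (1 - \<tau>) * x + of_real \<tau> * z
        = of_real a * e + of_real ((1 - \<tau>) * s x + \<tau> * s z) * (\<i> * e)"
      by (subst fr(1), subst fr(3)) (simp add: algebra_simps)
    also have "\<dots> = y" using fr(2) sy by simp
    finally have y: "of_real (1 - \<tau>) * x + of_real \<tau> * z = y" .
    have "x \<noteq> z" using less by auto
    then have "N y < 1" using N_between[of x z \<tau>] N \<tau> unfolding y by auto
    with N show False by simp
  qed
  have neq: "inner v (\<i> * e) \<noteq> inner w (\<i> * e)" if "v \<noteq> w" "inner v e = a" "inner w e = a" for v w
    using complex_eq_by_frame[OF e(1)] that by metis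
  have "inner x (\<i> * e) \<noteq> inner y (\<i> * e)" "inner y (\<i> * e) \<noteq> inner z (\<i> * e)"
    "inner x (\<i> * e) \<noteq> inner z (\<i> * e)" using neq ne e by auto
  then show False
    using ordered[OF N(1,2,3) e(2,3,4)] ordered[OF N(1,3,2) e(2,4,3)] ordered[OF N(2,1,3) e(3,2,4)]
      ordered[OF N(2,3,1) e(3,4,2)] ordered[OF N(3,1,2) e(4,2,3)] ordered[OF N(3,2,1) e(4,3,2)]
    by (metis linorder_neqE)
qed

text \<open>Reduced to \<open>[0, 2\<pi>)\<close>, the two parameters agree, so they differ by an
  integer multiple of the period, which can only be zero.\<close>

lemma curve_inj:
  assumes "\<gamma> s = \<gamma> t" "\<bar>s - t\<bar> < 2 * pi"
  shows "s = t"
proof -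
  interpret periodic_fun_simple \<gamma> "2 * pi" by standard (rule periodic)
  define r where "r = (\<lambda>t::real. t - 2 * pi * of_int \<lfloor>t / (2 * pi)\<rfloor>)"
  have \<gamma>r: "\<gamma> (r t) = \<gamma> t" for t
    using minus_of_int[of t "\<lfloor>t / (2 * pi)\<rfloor>"] by (simp add: r_def mult.commute)
  have "r t \<in> {0..<2 * pi}" for t
  proof -
    have "of_int \<lfloor>t / (2 * pi)\<rfloor> * (2 * pi) \<le> t" "t < (of_int \<lfloor>t / (2 * pi)\<rfloor> + 1) * (2 * pi)"
      using floor_divide_lower[of "2 * pi" t] floor_divide_upper[of "2 * pi" t] by auto
    then show ?thesis by (simp add: r_def algebra_simps)
  qed
  then have "r s = r t" using inj assms(1) \<gamma>r by (metis inj_onD)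
  then have eq: "s - t = 2 * pi * of_int (\<lfloor>s / (2 * pi)\<rfloor> - \<lfloor>t / (2 * pi)\<rfloor>)"
    by (simp add: r_def algebra_simps)
  then have "\<bar>of_int (\<lfloor>s / (2 * pi)\<rfloor> - \<lfloor>t / (2 * pi)\<rfloor>) :: real\<bar> < 1"
    using assms(2) by (simp add: abs_mult)
  then have "\<lfloor>s / (2 * pi)\<rfloor> - \<lfloor>t / (2 * pi)\<rfloor> = 0" by linarith
  with eq show ?thesis by simp
qed

lemma curve_onto:
  assumes "N z = 1"
  obtains t where "c \<le> t" "t < c + 2 * pi" "\<gamma> t = z"
proof -
  interpret periodic_fun_simple \<gamma> "2 * pi" by standard (rule periodic)
  have "z \<in> range \<gamma>" unfolding range using assms by simp
  then obtain s where s: "z = \<gamma> s" by blast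
  define k where "k = \<lfloor>(s - c) / (2 * pi)\<rfloor>"
  define t where "t = s - of_int k * (2 * pi)"
  have "of_int k * (2 * pi) \<le> s - c" "s - c < (of_int k + 1) * (2 * pi)"
    unfolding k_def using floor_divide_lower[of "2 * pi" "s - c"] floor_divide_upper[of "2 * pi" "s - c"]
    by auto
  then have "c \<le> t" "t < c + 2 * pi" by (auto simp: t_def algebra_simps)
  moreover have "\<gamma> t = z" using minus_of_int[of s k] s by (simp add: t_def)
  ultimately show ?thesis using that by blast
qed

lemma curve_continuous: "continuous_on S \<gamma>"
  using deriv by (meson continuous_at_imp_continuous_on has_vector_derivative_continuous)

lemma curve_lipschitz: "cmod (\<gamma> s - \<gamma> t) \<le> \<bar>s - t\<bar>"
proof -
  have *: "cmod (\<gamma> t - \<gamma> s) \<le> t - s" if "s \<le> t" for s t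
  proof -
    have "(\<gamma>' has_integral (\<gamma> t - \<gamma> s)) {s..t}"
      using that deriv by (intro fundamental_theorem_of_calculus) (auto intro: has_vector_derivative_at_within)
    from has_integral_bound_real[OF _ _ this, of 1 "{}"] show ?thesis
      using that speed by simp
  qed
  show ?thesis using *[of s t] *[of t s] by (cases "s \<le> t") (auto simp: norm_minus_commute)
qed

lemma det_le: "\<bar>Im (cnj (\<gamma> t) * \<gamma>' t)\<bar> \<le> R"
proof -
  have "\<bar>Im (cnj (\<gamma> t) * \<gamma>' t)\<bar> \<le> cmod (cnj (\<gamma> t) * \<gamma>' t)" by (rule abs_Im_le_cmod)
  also have "\<dots> = cmod (\<gamma> t)" by (simp add: norm_mult speed)
  finally show ?thesis using norm_curve_le[of t] by simp
qed


section \<open>The two arcs cut off by a chord\<close>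

lemma arc_one_side:
  assumes "c < d" "d < c + 2 * pi" "cmod \<nu> = 1" "inner (\<gamma> c) \<nu> = a" "inner (\<gamma> d) \<nu> = a"
  shows "(\<forall>t\<in>{c<..<d}. inner (\<gamma> t) \<nu> > a) \<or> (\<forall>t\<in>{c<..<d}. inner (\<gamma> t) \<nu> < a)"
proof -
  let ?h = "\<lambda>t. inner (\<gamma> t) \<nu>"
  \<comment> \<open>A third boundary point on the line of the chord contradicts strict convexity; so
    the open arc avoids the line, and connectedness keeps it on one side.\<close>
  have ne: "?h t \<noteq> a" if "t \<in> {c<..<d}" for t
  proof
    assume "?h t = a"
    moreover have "\<gamma> t \<noteq> \<gamma> c" "\<gamma> t \<noteq> \<gamma> d" "\<gamma> c \<noteq> \<gamma> d"
      using curve_inj[of t c] curve_inj[of t d] curve_inj[of c d] that assms by auto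
    ultimately show False
      using no_three_collinear[of "\<gamma> t" "\<gamma> c" "\<gamma> d" \<nu> a] assms by simp
  qed
  have "connected (?h ` {c<..<d})"
    by (intro connected_continuous_image continuous_intros curve_continuous) auto
  note conn = connectedD_interval[OF this]
  show ?thesis
  proof (rule ccontr)
    assume "\<not> ?thesis"
    then obtain s t where st: "s \<in> {c<..<d}" "t \<in> {c<..<d}" "?h s \<le> a" "?h t \<ge> a"
      unfolding de_Morgan_disj ball_simps not_less by blast
    have "a \<in> ?h ` {c<..<d}" by (rule conn[OF imageI[OF st(1)] imageI[OF st(2)] st(3,4)])
    with ne show False by blast
  qed
qed

text \<open>Origin of the length scale \<open>1 / K\<close>: since \<open>N \<nu> \<le> K\<close>,
  the ball reaches at least that far in every direction.\<close>

lemma point_in_direction: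
  assumes "cmod \<nu> = 1"
  shows "N (\<nu> / of_real (N \<nu>)) = 1" "inner (\<nu> / of_real (N \<nu>)) \<nu> \<ge> 1 / K"
proof -
  have pos: "N \<nu> > 0" using assms by (intro N_pos) auto
  have eq: "\<nu> / of_real (N \<nu>) = of_real (1 / N \<nu>) * \<nu>" by (simp add: divide_simps)
  show "N (\<nu> / of_real (N \<nu>)) = 1"
    unfolding eq homogeneous using pos by simp
  have "inner (\<nu> / of_real (N \<nu>)) \<nu> = (1 / N \<nu>) * inner \<nu> \<nu>"
    unfolding eq by (simp add: inner_complex_def algebra_simps add_divide_distrib)
  also have "\<dots> = 1 / N \<nu>" using assms by (simp add: dot_square_norm)
  finally show "inner (\<nu> / of_real (N \<nu>)) \<nu> \<ge> 1 / K"
    using N_le[of \<nu>] assms pos K by (simp add: frac_le)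
qed

text \<open>For \<open>a > 0\<close> the midpoint of the chord lies strictly inside the ball, so
  pushing it radially out to the boundary raises its height. For \<open>a = 0\<close> the boundary
  point in direction \<open>\<nu>\<close> will do.\<close>

lemma exists_above_chord:
  assumes z: "N zp = 1" "N zm = 1" "zp \<noteq> zm" and \<nu>: "cmod \<nu> = 1"
    and a: "inner zp \<nu> = a" "inner zm \<nu> = a" "a \<ge> 0"
  obtains z where "N z = 1" "inner z \<nu> > a"
proof (cases "a = 0")
  case True
  have "1 / K > 0" using K by simp
  then show ?thesis
    using that[of "\<nu> / of_real (N \<nu>)"] point_in_direction[OF \<nu>] True by linarith
next
  case False
  define m where "m = (zp + zm) / 2"
  have "inner m \<nu> = (inner zp \<nu> + inner zm \<nu>) / 2"
    by (simp add: m_def inner_complex_def field_simps)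
  then have im: "inner m \<nu> = a" using a by simp
  have "m \<noteq> 0" using im False by auto
  then have m: "N m > 0" by (rule N_pos)
  have m1: "N m < 1" unfolding m_def using strict z by auto
  have "N (of_real (1 / N m) * m) = 1" unfolding homogeneous using m by simp
  moreover have "inner (of_real (1 / N m) * m) \<nu> = (1 / N m) * a"
    unfolding im[symmetric] by (simp add: inner_complex_def algebra_simps add_divide_distrib)
  moreover have "(1 / N m) * a > 1 * a"
    using m m1 a False by (intro mult_strict_right_mono) auto
  ultimately show ?thesis by (intro that[of "of_real (1 / N m) * m"]) auto
qed

text \<open>Each arc stays on one side of the chord, and as the boundary has points on both sides,
  the arcs take different ones. The upper arc may pass through parameter \<open>0\<close>, whence
  the shift by \<open>2 * pi\<close>; the last conclusion records which case occurs, for the signs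
  in \<open>cENT\<close>.\<close>

lemma chord_arc:
  assumes z: "\<gamma> \<theta>p \<noteq> \<gamma> \<theta>m" and \<theta>: "\<theta>p \<in> {0..<2 * pi}" "\<theta>m \<in> {0..<2 * pi}"
    and \<nu>: "cmod \<nu> = 1" and a: "inner (\<gamma> \<theta>p) \<nu> = a" "inner (\<gamma> \<theta>m) \<nu> = a" "a \<ge> 0"
  obtains \<alpha> \<beta> where "0 \<le> \<alpha>" "\<alpha> < 2 * pi" "\<alpha> < \<beta>" "\<beta> < \<alpha> + 2 * pi"
    "{\<gamma> \<alpha>, \<gamma> \<beta>} = {\<gamma> \<theta>p, \<gamma> \<theta>m}"
    "\<forall>t\<in>{\<alpha><..<\<beta>}. inner (\<gamma> t) \<nu> > a"
    "\<forall>t\<in>{\<beta><..<\<alpha> + 2 * pi}. inner (\<gamma> t) \<nu> < a"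
    "(\<alpha> = min \<theta>p \<theta>m \<and> \<beta> = max \<theta>p \<theta>m) \<or> (\<alpha> = max \<theta>p \<theta>m \<and> \<beta> = min \<theta>p \<theta>m + 2 * pi)"
proof -
  define l h where "l = min \<theta>p \<theta>m" and "h = max \<theta>p \<theta>m"
  have lh: "0 \<le> l" "l < h" "h < 2 * pi" "h < l + 2 * pi"
    using z \<theta> by (cases "\<theta>p = \<theta>m"; auto simp: l_def h_def)+
  have ends: "{\<gamma> l, \<gamma> h} = {\<gamma> \<theta>p, \<gamma> \<theta>m}" "{\<gamma> h, \<gamma> (l + 2 * pi)} = {\<gamma> \<theta>p, \<gamma> \<theta>m}"
    by (auto simp: l_def h_def min_def max_def periodic)
  have al: "inner (\<gamma> l) \<nu> = a" "inner (\<gamma> h) \<nu> = a" "inner (\<gamma> (l + 2 * pi)) \<nu> = a"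
    using a by (auto simp: l_def h_def min_def max_def periodic)
  let ?U = "\<lambda>S. \<forall>t\<in>S. inner (\<gamma> t) \<nu> > a" and ?D = "\<lambda>S. \<forall>t\<in>S. inner (\<gamma> t) \<nu> < a"
  have 1: "?U {l<..<h} \<or> ?D {l<..<h}"
    using arc_one_side[of l h \<nu> a] lh \<nu> al by auto
  have 2: "?U {h<..<l + 2 * pi} \<or> ?D {h<..<l + 2 * pi}"
    using arc_one_side[of h "l + 2 * pi" \<nu> a] lh \<nu> al by auto
  have split: "t \<in> {l<..<h} \<or> t \<in> {h<..<l + 2 * pi}"
    if "l \<le> t" "t < l + 2 * pi" "inner (\<gamma> t) \<nu> \<noteq> a" for t
    using that al by (cases "t = l"; cases "t = h") auto
  obtain z1 where "N z1 = 1" "inner z1 \<nu> > a"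
    using exists_above_chord[of "\<gamma> \<theta>p" "\<gamma> \<theta>m" \<nu> a] z \<nu> a by auto
  then obtain t1 where t1: "l \<le> t1" "t1 < l + 2 * pi" "inner (\<gamma> t1) \<nu> > a"
    using curve_onto[of z1 l] by metis
  \<comment> \<open>The boundary point in direction \<open>- \<nu>\<close> has negative height,
    hence lies below the chord because \<open>a \<ge> 0\<close>.\<close>
  have "N (- \<nu> / of_real (N (- \<nu>))) = 1" "inner (- \<nu> / of_real (N (- \<nu>))) (- \<nu>) \<ge> 1 / K"
    using point_in_direction[of "- \<nu>"] \<nu> by auto
  moreover have "1 / K > 0" using K by simp
  ultimately obtain t2 where t2: "l \<le> t2" "t2 < l + 2 * pi" "inner (\<gamma> t2) \<nu> < a"
    using curve_onto[of "- \<nu> / of_real (N (- \<nu>))" l] a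
    by (smt (verit, ccfv_threshold) inner_minus_right)
  have s: "t1 \<in> {l<..<h} \<or> t1 \<in> {h<..<l + 2 * pi}" "t2 \<in> {l<..<h} \<or> t2 \<in> {h<..<l + 2 * pi}"
    using split[of t1] split[of t2] t1 t2 by auto
  consider "?U {l<..<h}" "?D {h<..<l + 2 * pi}" | "?D {l<..<h}" "?U {h<..<l + 2 * pi}"
    using 1 2 s t1(3) t2(3) by (metis less_asym)
  then show ?thesis
  proof cases
    case 1
    then show ?thesis using that[of l h] lh ends by (auto simp: l_def h_def)
  next
    case 2
    have D: "inner (\<gamma> t) \<nu> < a" if "t \<in> {l + 2 * pi<..<h + 2 * pi}" for t
    proof -
      have "t - 2 * pi \<in> {l<..<h}" using that by auto
      then have "inner (\<gamma> (t - 2 * pi)) \<nu> < a" using 2(1) by blast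
      moreover have "\<gamma> t = \<gamma> (t - 2 * pi)" using periodic[of "t - 2 * pi"] by (simp only: diff_add_cancel)
      ultimately show ?thesis by simp
    qed
    show ?thesis
    proof (rule that[of h "l + 2 * pi"])
      show "{\<gamma> h, \<gamma> (l + 2 * pi)} = {\<gamma> \<theta>p, \<gamma> \<theta>m}" by (rule ends)
      show "h = min \<theta>p \<theta>m \<and> l + 2 * pi = max \<theta>p \<theta>m \<or> h = max \<theta>p \<theta>m \<and> l + 2 * pi = min \<theta>p \<theta>m + 2 * pi"
        by (simp add: l_def h_def)
    qed (use lh 2(2) D in auto)
  qed
qed

subsection \<open>Moment problems on short arcs\<close>

text \<open>A continuous weight, positive exactly on the arcs of radius \<open>\<rho>\<close> around \<open>c\<close> modulo
  \<open>2\<pi>\<close>, so that periodicity needs no separate treatment.\<close>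

definition bump :: "real \<Rightarrow> real \<Rightarrow> real \<Rightarrow> real" where
  "bump \<rho> c t = max 0 (cos (t - c) - cos \<rho>)"

text \<open>The Gram operator of \<open>1\<close> and the two coordinates of \<open>\<gamma>\<close>
  with weight \<open>bump \<rho> c\<close>. Inverting it produces a function supported near
  \<open>c\<close> with prescribed moments.\<close>

definition moment :: "real \<Rightarrow> real \<Rightarrow> real \<times> complex \<Rightarrow> real \<times> complex" where
  "moment \<rho> c x = integral {0..2 * pi} (\<lambda>t. (bump \<rho> c t * inner x (1, \<gamma> t)) *\<^sub>R (1, \<gamma> t))"

lemma bump_props: "continuous_on S (bump \<rho> c)" "bump \<rho> c (t + 2 * pi) = bump \<rho> c t"
  "0 \<le> bump \<rho> c t" "bump \<rho> c t \<le> 2"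
proof -
  show "continuous_on S (bump \<rho> c)" unfolding bump_def by (intro continuous_intros)
  have "cos (t + 2 * pi - c) = cos (t - c)"
    using cos_periodic[of "t - c"] by (simp add: algebra_simps)
  then show "bump \<rho> c (t + 2 * pi) = bump \<rho> c t" by (simp add: bump_def)
  show "0 \<le> bump \<rho> c t" by (simp add: bump_def)
  have "cos (t - c) - cos \<rho> \<le> 2"
    using cos_le_one[of "t - c"] cos_ge_minus_one[of \<rho>] by linarith
  then show "bump \<rho> c t \<le> 2" by (simp add: bump_def)
qed

lemma moment_integrand_continuous:
  "continuous_on S (\<lambda>t. (bump \<rho> c t * inner x (1, \<gamma> t)) *\<^sub>R (1 :: real, \<gamma> t))"
  by (intro continuous_intros bump_props curve_continuous)

lemma moment_linear: "linear (moment \<rho> c)"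
proof (rule linearI)
  note int = integrable_continuous_real[OF moment_integrand_continuous]
  show "moment \<rho> c (x + y) = moment \<rho> c x + moment \<rho> c y" for x y
    unfolding moment_def
    by (subst integral_add[OF int int, symmetric])
      (simp only: inner_add_left ring_distribs scaleR_add_left)
  show "moment \<rho> c (r *\<^sub>R x) = r *\<^sub>R moment \<rho> c x" for r x
    unfolding moment_def
    by (subst integral_cmul[symmetric]) (simp only: inner_scaleR_left scaleR_scaleR mult.left_commute)
qed

text \<open>Since no arc lies on a line, \<open>x \<bullet> moment \<rho> c x = \<integral> bump \<sqdot> (x \<bullet> (1, \<gamma>))\<^sup>2\<close> is positive definite.\<close>

lemma moment_inj:
  assumes \<rho>: "0 < \<rho>" "\<rho> < pi"
  shows "inj (moment \<rho> c)"
proof -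
  have "x = 0" if x: "moment \<rho> c x = 0" for x
  proof -
    let ?q = "\<lambda>t. bump \<rho> c t * (inner x (1, \<gamma> t))\<^sup>2"
    have q: "continuous_on S ?q" for S by (intro continuous_intros bump_props curve_continuous)
    have "inner x (moment \<rho> c x) = integral {0..2 * pi} (inner x \<circ> (\<lambda>t. (bump \<rho> c t * inner x (1, \<gamma> t)) *\<^sub>R (1, \<gamma> t)))"
      unfolding moment_def
      by (intro integral_linear[symmetric] integrable_continuous_real moment_integrand_continuous
          bounded_linear_inner_right)
    also have "\<dots> = integral {0..2 * pi} ?q"
      by (intro integral_cong) (simp only: o_def inner_scaleR_right power2_eq_square mult.assoc)
    \<comment> \<open>Centring the period at \<open>c\<close> puts the whole arc of radius
      \<open>\<rho> < pi\<close> inside one interval of integration.\<close>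
    also have "\<dots> = integral {c - pi..c - pi + 2 * pi} ?q"
      by (intro integral_periodic_shift[symmetric] q) (simp_all add: bump_props periodic)
    finally have "integral {c - pi..c + pi} ?q = 0" using x by (simp add: add.commute)
    then have q0: "?q t = 0" if "t \<in> {c - pi..c + pi}" for t
      using integral_eq_0_iff[OF q, of "c - pi" "c + pi"] bump_props(3) that by auto
    have vanish: "inner x (1, \<gamma> t) = 0" if "\<bar>t - c\<bar> < \<rho>" for t
    proof -
      have "cos (t - c) > cos \<rho>"
        using cos_monotone_0_pi[of "\<bar>t - c\<bar>" \<rho>] that \<rho> by simp
      then have "bump \<rho> c t > 0" by (simp add: bump_def)
      moreover have "?q t = 0" using that \<rho> by (intro q0) auto
      ultimately show ?thesis by simp
    qed
    obtain r w where rw: "x = (r, w)" by fastforce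
    have h: "r + inner w (\<gamma> t) = 0" if "\<bar>t - c\<bar> < \<rho>" for t
      using vanish[OF that] rw by simp
    have "w = 0"
    proof (rule ccontr)
      assume w: "w \<noteq> 0"
      define e where "e = w /\<^sub>R cmod w"
      have e: "cmod e = 1" using w by (simp add: e_def)
      have line: "inner (\<gamma> t) e = - r / cmod w" if "\<bar>t - c\<bar> < \<rho>" for t
      proof -
        have "inner (\<gamma> t) w = - r" using h[OF that] by (simp add: inner_commute)
        then show ?thesis by (simp add: e_def divide_inverse mult.commute)
      qed
      \<comment> \<open>Three distinct points of the arc; for \<open>w \<noteq> 0\<close> they would
        all lie on one line.\<close>
      have "\<gamma> (c - \<rho>/2) \<noteq> \<gamma> c" "\<gamma> c \<noteq> \<gamma> (c + \<rho>/2)" "\<gamma> (c - \<rho>/2) \<noteq> \<gamma> (c + \<rho>/2)"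
        using curve_inj[of "c - \<rho>/2" c] curve_inj[of c "c + \<rho>/2"]
          curve_inj[of "c - \<rho>/2" "c + \<rho>/2"] \<rho> by auto
      moreover have "inner (\<gamma> (c - \<rho>/2)) e = - r / cmod w" "inner (\<gamma> c) e = - r / cmod w"
        "inner (\<gamma> (c + \<rho>/2)) e = - r / cmod w"
        using \<rho> by (intro line; simp)+
      ultimately show False
        using no_three_collinear[OF N_curve N_curve N_curve _ _ _ e] by blast
    qed
    moreover have "r = 0" using h[of c] \<open>w = 0\<close> \<rho> by simp
    ultimately show ?thesis using rw by (simp add: zero_prod_def)
  qed
  then show ?thesis by (subst linear_injective_0[OF moment_linear]) auto
qed

text \<open>An injective linear map of a finite-dimensional space is onto and bounded below. The
  constant still depends on \<open>c\<close>.\<close>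

lemma moment_inverse:
  assumes "0 < \<rho>" "\<rho> < pi"
  shows "\<exists>C>0. \<forall>m. \<exists>x. norm x \<le> C * norm m \<and> moment \<rho> c x = m"
proof -
  obtain B where B: "B > 0" "\<And>x. B * norm x \<le> norm (moment \<rho> c x)"
    using linear_inj_bounded_below_pos[OF moment_linear moment_inj[OF assms]] by blast
  have surj: "surj (moment \<rho> c)"
    by (rule linear_injective_imp_surjective[OF moment_linear moment_inj[OF assms]]) simp
  have "\<exists>x. norm x \<le> (1 / B) * norm m \<and> moment \<rho> c x = m" for m
  proof -
    obtain x where "moment \<rho> c x = m" using surj by (metis surjD)
    then show ?thesis using B(1) B(2)[of x] by (intro exI[of _ x]) (auto simp: field_simps)
  qed
  then show ?thesis using B(1) by (intro exI[of _ "1 / B"]) auto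
qed

text \<open>Uniformity in \<open>s\<close> comes from restricting the centres \<open>c\<close> to a finite grid.\<close>

lemma moment_inverse_uniform:
  assumes \<rho>: "0 < \<rho>" "\<rho> < pi"
  obtains C where "C > 0"
    "\<And>s. s \<in> {0..4 * pi} \<Longrightarrow> \<exists>c. \<bar>c - s\<bar> \<le> \<rho> \<and> (\<forall>m. \<exists>x. norm x \<le> C * norm m \<and> moment \<rho> c x = m)"
proof -
  \<comment> \<open>Largest index needed for a grid of step \<open>\<rho>\<close> on
    \<open>[0, 4\<pi>]\<close>, the range of the points supplied by \<open>cap_gap\<close>.\<close>
  define M where "M = nat \<lfloor>4 * pi / \<rho>\<rfloor>"
  obtain B where B: "\<And>k. B k > 0"
    "\<And>k m. \<exists>x. norm x \<le> B k * norm m \<and> moment \<rho> (real k * \<rho>) x = m"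
  proof -
    have "\<forall>k::nat. \<exists>C>0. \<forall>m. \<exists>x. norm x \<le> C * norm m \<and> moment \<rho> (real k * \<rho>) x = m"
      using moment_inverse[OF \<rho>] by blast
    from choice[OF this] show thesis using that by blast
  qed
  define C where "C = (\<Sum>k\<le>M. B k)"
  have BC: "B k \<le> C" if "k \<le> M" for k
    unfolding C_def using that B(1) by (intro member_le_sum) (auto intro: less_imp_le)
  show ?thesis
  proof (rule that[of C])
    show "C > 0" using BC[of 0] B(1)[of 0] by simp
    fix s assume s: "s \<in> {0..4 * pi}"
    define k where "k = nat \<lfloor>s / \<rho>\<rfloor>"
    have "s / \<rho> \<le> 4 * pi / \<rho>" using s \<rho> by (intro divide_right_mono) auto
    then have kM: "k \<le> M" unfolding k_def M_def by (intro nat_mono floor_mono)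
    have "real k = of_int \<lfloor>s / \<rho>\<rfloor>" using s \<rho> by (simp add: k_def)
    then have "real k * \<rho> \<le> s" "s < (real k + 1) * \<rho>"
      using floor_divide_lower[of \<rho> s] floor_divide_upper[of \<rho> s] \<rho> by auto
    then have "\<bar>real k * \<rho> - s\<bar> \<le> \<rho>" by (simp add: algebra_simps)
    moreover have "\<exists>x. norm x \<le> C * norm m \<and> moment \<rho> (real k * \<rho>) x = m" for m
    proof -
      obtain x where "norm x \<le> B k * norm m" "moment \<rho> (real k * \<rho>) x = m" using B(2) by blast
      moreover have "B k * norm m \<le> C * norm m" using BC[OF kM] by (intro mult_right_mono) auto
      ultimately show ?thesis by (intro exI[of _ x]) auto
    qed
    ultimately show "\<exists>c. \<bar>c - s\<bar> \<le> \<rho> \<and> (\<forall>m. \<exists>x. norm x \<le> C * norm m \<and> moment \<rho> c x = m)"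
      by blast
  qed
qed


subsection \<open>Duality for the entropy cost\<close>

definition admissible :: "(real \<Rightarrow> real) set" where
  "admissible = {f. continuous_on UNIV f \<and> (\<forall>t. f (t + 2 * pi) = f t) \<and> (\<forall>t. \<bar>f t\<bar> \<le> 1) \<and>
     integral {0..2 * pi} f = 0 \<and> integral {0..2 * pi} (\<lambda>t. f t *\<^sub>R \<gamma> t) = 0}"

text \<open>Only \<open>\<alpha>\<close> is normalized to one period; \<open>\<beta>\<close> may
  exceed \<open>2\<pi>\<close>, so that the arc is always an interval.\<close>

definition cap :: "complex \<Rightarrow> real \<Rightarrow> real \<Rightarrow> real \<Rightarrow> bool" where
  "cap \<nu> a \<alpha> \<beta> \<longleftrightarrow> cmod \<nu> = 1 \<and> 0 \<le> a \<and> 0 \<le> \<alpha> \<and> \<alpha> < 2 * pi \<and> \<alpha> < \<beta> \<and> \<beta> < \<alpha> + 2 * pi \<and>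
     inner (\<gamma> \<alpha>) \<nu> = a \<and> inner (\<gamma> \<beta>) \<nu> = a \<and>
     (\<forall>t\<in>{\<alpha><..<\<beta>}. inner (\<gamma> t) \<nu> > a) \<and> (\<forall>t\<in>{\<beta><..<\<alpha> + 2 * pi}. inner (\<gamma> t) \<nu> < a)"

definition height :: "complex \<Rightarrow> real \<Rightarrow> real \<Rightarrow> real" where
  "height \<nu> a t = inner (\<gamma> t) \<nu> - a"

definition pairing :: "complex \<Rightarrow> real \<Rightarrow> real \<Rightarrow> real \<Rightarrow> (real \<Rightarrow> real) \<Rightarrow> real" where
  "pairing \<nu> a \<alpha> \<beta> f = integral {\<alpha>..\<beta>} (\<lambda>t. f t * height \<nu> a t)"

definition cap_area :: "complex \<Rightarrow> real \<Rightarrow> real \<Rightarrow> real \<Rightarrow> real" where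
  "cap_area \<nu> a \<alpha> \<beta> = integral {\<alpha>..\<beta>} (height \<nu> a)"

lemma height_continuous: "continuous_on S (height \<nu> a)"
  unfolding height_def by (intro continuous_intros curve_continuous)

lemma height_periodic: "height \<nu> a (t + 2 * pi) = height \<nu> a t"
  by (simp add: height_def periodic)

lemma height_lipschitz:
  assumes "cmod \<nu> = 1"
  shows "\<bar>height \<nu> a s - height \<nu> a t\<bar> \<le> \<bar>s - t\<bar>"
proof -
  have "\<bar>height \<nu> a s - height \<nu> a t\<bar> = \<bar>inner (\<gamma> s - \<gamma> t) \<nu>\<bar>"
    by (simp add: height_def inner_diff_left)
  also have "\<dots> \<le> cmod (\<gamma> s - \<gamma> t) * cmod \<nu>" by (rule Cauchy_Schwarz_ineq2)
  finally show ?thesis using curve_lipschitz[of s t] assms by simp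
qed

lemma cap_height:
  assumes "cap \<nu> a \<alpha> \<beta>"
  shows "t \<in> {\<alpha>..\<beta>} \<Longrightarrow> height \<nu> a t \<ge> 0" "height \<nu> a \<alpha> = 0" "height \<nu> a \<beta> = 0"
proof -
  show "height \<nu> a \<alpha> = 0" "height \<nu> a \<beta> = 0"
    using assms by (auto simp: cap_def height_def)
  then show "height \<nu> a t \<ge> 0" if "t \<in> {\<alpha>..\<beta>}"
    using assms that by (cases "t = \<alpha> \<or> t = \<beta>") (auto simp: cap_def height_def less_imp_le)
qed

text \<open>The fundamental theorem for the gauge integral yields integrability of the sum of both
  terms; the integrability of \<open>l * \<gamma>'\<close> then follows by subtracting the
  continuous one.\<close>

lemma curve_integral_by_parts:
  assumes f: "continuous_on UNIV f" and l: "\<And>t. (l has_real_derivative f t) (at t)" and "a \<le> b"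
  shows "((\<lambda>t. l t *\<^sub>R \<gamma>' t) has_integral
    (l b *\<^sub>R \<gamma> b - l a *\<^sub>R \<gamma> a - integral {a..b} (\<lambda>t. f t *\<^sub>R \<gamma> t))) {a..b}"
proof -
  have d: "((\<lambda>t. l t *\<^sub>R \<gamma> t) has_vector_derivative l t *\<^sub>R \<gamma>' t + f t *\<^sub>R \<gamma> t) (at t within {a..b})" for t
    using has_vector_derivative_scaleR[OF has_field_derivative_at_within[OF l]
        has_vector_derivative_at_within[OF deriv]] .
  have 1: "((\<lambda>t. l t *\<^sub>R \<gamma>' t + f t *\<^sub>R \<gamma> t) has_integral l b *\<^sub>R \<gamma> b - l a *\<^sub>R \<gamma> a) {a..b}"
    using \<open>a \<le> b\<close> d by (rule fundamental_theorem_of_calculus)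
  have "(\<lambda>t. f t *\<^sub>R \<gamma> t) integrable_on {a..b}"
    by (intro integrable_continuous_real continuous_intros curve_continuous
        continuous_on_subset[OF f]) auto
  from has_integral_diff[OF 1 integrable_integral[OF this]] show ?thesis by simp
qed

text \<open>The primitive of \<open>\<gamma>' \<bullet> \<nu>\<close> is normalized to vanish at
  both ends of the chord, which removes the boundary terms.\<close>

lemma pairing_by_parts:
  assumes f: "continuous_on UNIV f" and l: "\<And>t. (l has_real_derivative f t) (at t)" and "\<alpha> \<le> \<beta>"
    and ends: "inner (\<gamma> \<alpha>) \<nu> = a" "inner (\<gamma> \<beta>) \<nu> = a"
  shows "integral {\<alpha>..\<beta>} (\<lambda>t. l t * inner (\<gamma>' t) \<nu>) = - pairing \<nu> a \<alpha> \<beta> f"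
proof -
  have "((\<lambda>t. inner (\<gamma> t) \<nu>) has_vector_derivative inner (\<gamma>' t) \<nu>) (at t)" for t
    by (rule bounded_linear.has_vector_derivative[OF bounded_linear_inner_left deriv])
  then have h: "(height \<nu> a has_real_derivative inner (\<gamma>' t) \<nu>) (at t)" for t
    unfolding height_def has_real_derivative_iff_has_vector_derivative
    by (auto intro!: derivative_eq_intros)
  have d: "((\<lambda>t. l t * height \<nu> a t) has_vector_derivative
      l t * inner (\<gamma>' t) \<nu> + f t * height \<nu> a t) (at t within {\<alpha>..\<beta>})" for t
    using has_field_derivative_at_within[OF DERIV_mult'[OF l h]]
    unfolding has_real_derivative_iff_has_vector_derivative .
  have 1: "((\<lambda>t. l t * inner (\<gamma>' t) \<nu> + f t * height \<nu> a t) has_integral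
      l \<beta> * height \<nu> a \<beta> - l \<alpha> * height \<nu> a \<alpha>) {\<alpha>..\<beta>}"
    using \<open>\<alpha> \<le> \<beta>\<close> d by (rule fundamental_theorem_of_calculus)
  have "(\<lambda>t. f t * height \<nu> a t) integrable_on {\<alpha>..\<beta>}"
    by (intro integrable_continuous_real continuous_intros height_continuous
        continuous_on_subset[OF f]) auto
  from has_integral_diff[OF 1 integrable_integral[OF this]] show ?thesis
    using ends by (simp add: pairing_def height_def integral_unique)
qed

text \<open>Periodicity of \<open>l\<close> corresponds to zero mean of its derivative; over a full
  period the boundary terms cancel, which turns the constraint on \<open>l * \<gamma>'\<close> into
  one on \<open>f * \<gamma>\<close>.\<close>

lemma Lambda_star_iff:
  "l \<in> Lambda_star \<gamma> \<longleftrightarrow> (\<exists>f\<in>admissible. \<forall>t. (l has_real_derivative f t) (at t))"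
proof
  have vd: "vector_derivative \<gamma> (at t) = \<gamma>' t" for t
    using deriv by (rule vector_derivative_at)
  have \<gamma>2pi: "\<gamma> (2 * pi) = \<gamma> 0" using periodic[of 0] by simp
  {
    assume "l \<in> Lambda_star \<gamma>"
    then obtain f where per: "\<And>t. l (t + 2 * pi) = l t" and f: "continuous_on UNIV f"
      and l: "\<And>t. (l has_real_derivative f t) (at t)" and bd: "\<And>t. \<bar>f t\<bar> \<le> 1"
      and int: "integral {0..2 * pi} (\<lambda>t. l t *\<^sub>R \<gamma>' t) = 0"
      unfolding Lambda_star_def vd by (auto simp: scaleR_conv_of_real)
    have l2pi: "l (2 * pi) = l 0" using per[of 0] by simp
    have "f (t + 2 * pi) = f t" for t
      using l[of "t + 2 * pi"] l[of t] unfolding DERIV_shift per by (rule DERIV_unique)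
    moreover have "integral {0..2 * pi} f = 0"
      using fundamental_theorem_of_calculus[of 0 "2 * pi" l f] l l2pi
      by (auto simp: has_real_derivative_iff_has_vector_derivative integral_unique
          intro: has_vector_derivative_at_within)
    moreover have "integral {0..2 * pi} (\<lambda>t. f t *\<^sub>R \<gamma> t) = 0"
      using integral_unique[OF curve_integral_by_parts[OF f l, of 0 "2 * pi"]] int l2pi \<gamma>2pi by simp
    ultimately show "\<exists>f\<in>admissible. \<forall>t. (l has_real_derivative f t) (at t)"
      using f bd l by (intro bexI[of _ f]) (auto simp: admissible_def)
  next
    assume "\<exists>f\<in>admissible. \<forall>t. (l has_real_derivative f t) (at t)"
    then obtain f where f: "f \<in> admissible" and l: "\<And>t. (l has_real_derivative f t) (at t)" by blast
    have cont: "continuous_on UNIV f" using f by (simp add: admissible_def)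
    have per: "l (t + 2 * pi) = l t" for t
    proof -
      have "(f has_integral l (t + 2 * pi) - l t) {t..t + 2 * pi}"
        using l by (intro fundamental_theorem_of_calculus)
          (auto simp: has_real_derivative_iff_has_vector_derivative intro: has_vector_derivative_at_within)
      then have "l (t + 2 * pi) - l t = integral {t..t + 2 * pi} f" by (simp add: integral_unique)
      also have "\<dots> = integral {0..2 * pi} f"
        using f by (intro integral_periodic_shift cont) (auto simp: admissible_def)
      finally show ?thesis using f by (simp add: admissible_def)
    qed
    have l2pi: "l (2 * pi) = l 0" using per[of 0] by simp
    have "integral {0..2 * pi} (\<lambda>t. l t *\<^sub>R \<gamma>' t) = 0"
      using integral_unique[OF curve_integral_by_parts[OF cont l, of 0 "2 * pi"]] f l2pi \<gamma>2pi
      by (simp add: admissible_def)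
    then show "l \<in> Lambda_star \<gamma>"
      unfolding Lambda_star_def vd using per l f
      by (auto simp: scaleR_conv_of_real admissible_def intro!: exI[of _ f])
  }
qed

lemma admissible_minus: "f \<in> admissible \<Longrightarrow> (\<lambda>t. - f t) \<in> admissible"
  by (auto simp: admissible_def intro: continuous_intros)

lemma pairing_minus: "pairing \<nu> a \<alpha> \<beta> (\<lambda>t. - f t) = - pairing \<nu> a \<alpha> \<beta> f"
  by (simp add: pairing_def)

text \<open>The height is an affine function of \<open>\<gamma>\<close>, so an admissible
  \<open>f\<close> is orthogonal to it over a full period and the two arcs contribute opposite
  values. Thus the path in \<open>cENT\<close> may be replaced by the cap.\<close>

lemma pairing_complement:
  assumes f: "f \<in> admissible" and "\<alpha> \<le> \<beta>" "\<beta> \<le> \<alpha> + 2 * pi"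
  shows "pairing \<nu> a \<beta> (\<alpha> + 2 * pi) f = - pairing \<nu> a \<alpha> \<beta> f"
proof -
  have cont: "continuous_on S f" for S
    using f by (auto simp: admissible_def intro: continuous_on_subset)
  have cont_fh: "continuous_on S (\<lambda>t. f t * height \<nu> a t)" for S
    by (intro continuous_intros cont height_continuous)
  have "pairing \<nu> a \<alpha> \<beta> f + pairing \<nu> a \<beta> (\<alpha> + 2 * pi) f
      = integral {\<alpha>..\<alpha> + 2 * pi} (\<lambda>t. f t * height \<nu> a t)"
    unfolding pairing_def
    by (rule Henstock_Kurzweil_Integration.integral_combine[OF assms(2,3) integrable_continuous_real[OF cont_fh]])
  also have "\<dots> = integral {0..2 * pi} (\<lambda>t. f t * height \<nu> a t)"
    using f by (intro integral_periodic_shift cont_fh) (auto simp: height_periodic admissible_def)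
  also have "\<dots> = integral {0..2 * pi} (\<lambda>t. ((\<lambda>z. inner z \<nu>) \<circ> (\<lambda>t. f t *\<^sub>R \<gamma> t)) t - a * f t)"
    by (intro integral_cong) (simp add: height_def algebra_simps)
  also have "\<dots> = integral {0..2 * pi} ((\<lambda>z. inner z \<nu>) \<circ> (\<lambda>t. f t *\<^sub>R \<gamma> t))
      - integral {0..2 * pi} (\<lambda>t. a * f t)"
    by (intro integral_diff integrable_continuous_real continuous_on_compose continuous_intros cont curve_continuous)
  also have "\<dots> = inner (integral {0..2 * pi} (\<lambda>t. f t *\<^sub>R \<gamma> t)) \<nu> - a * integral {0..2 * pi} f"
    by (subst integral_linear) (auto intro!: integrable_continuous_real continuous_intros cont curve_continuous
        bounded_linear_inner_left)
  also have "\<dots> = 0" using f by (simp add: admissible_def)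
  finally show ?thesis by simp
qed

text \<open>The path from \<open>zm\<close> to \<open>zp\<close> may run backwards or along the
  complementary arc. Each changes only the sign of the pairing, and the supremum does not notice,
  since \<open>admissible\<close> is closed under negation.\<close>

lemma cENT_eq_Sup:
  assumes z: "N zp = 1" "N zm = 1" "zp \<noteq> zm"
    and \<nu>: "\<nu> = nu_vec zp zm" and a: "inner zp \<nu> = a" "a \<ge> 0"
  obtains \<alpha> \<beta> where "cap \<nu> a \<alpha> \<beta>" "{\<gamma> \<alpha>, \<gamma> \<beta>} = {zp, zm}"
    "cENT N \<gamma> zp zm = Sup (pairing \<nu> a \<alpha> \<beta> ` admissible)"
proof -
  have norm\<nu>: "cmod \<nu> = 1" using norm_nu_vec[OF z(3)] by (simp add: \<nu>)
  have a': "inner zm \<nu> = a" using a inner_nu_vec[of zp zm] by (simp add: \<nu>)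
  have param: "param_of \<gamma> z \<in> {0..<2 * pi} \<and> \<gamma> (param_of \<gamma> z) = z" if "N z = 1" for z
  proof -
    obtain t where "t \<in> {0..<2 * pi} \<and> \<gamma> t = z" using curve_onto[OF \<open>N z = 1\<close>, of 0] by auto
    then show ?thesis unfolding param_of_def by (rule someI)
  qed
  define p m where "p = param_of \<gamma> zp" and "m = param_of \<gamma> zm"
  have pm: "p \<in> {0..<2 * pi}" "m \<in> {0..<2 * pi}" "\<gamma> p = zp" "\<gamma> m = zm"
    using param z by (auto simp: p_def m_def)
  obtain \<alpha> \<beta> where \<alpha>\<beta>: "0 \<le> \<alpha>" "\<alpha> < 2 * pi" "\<alpha> < \<beta>" "\<beta> < \<alpha> + 2 * pi"
    "{\<gamma> \<alpha>, \<gamma> \<beta>} = {zp, zm}"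
    "\<forall>t\<in>{\<alpha><..<\<beta>}. inner (\<gamma> t) \<nu> > a"
    "\<forall>t\<in>{\<beta><..<\<alpha> + 2 * pi}. inner (\<gamma> t) \<nu> < a"
    and or: "(\<alpha> = min p m \<and> \<beta> = max p m) \<or> (\<alpha> = max p m \<and> \<beta> = min p m + 2 * pi)"
    by (rule chord_arc[of p m \<nu> a, unfolded pm(3,4), OF z(3) pm(1,2) norm\<nu> a(1) a' a(2)])
  have ends: "inner (\<gamma> \<alpha>) \<nu> = a" "inner (\<gamma> \<beta>) \<nu> = a"
    using \<alpha>\<beta>(5) a a' by (auto simp: doubleton_eq_iff)
  have cap: "cap \<nu> a \<alpha> \<beta>"
    using \<alpha>\<beta> ends norm\<nu> a by (auto simp: cap_def)
  define g where "g = (\<lambda>l. oint m p (\<lambda>t. l t * inner (vector_derivative \<gamma> (at t)) \<nu>))"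
  define low where "low \<longleftrightarrow> \<alpha> = min p m \<and> \<beta> = max p m"
  \<comment> \<open>Product of three signs: the direction of integration, the minus of integration
    by parts, and the passage to the complementary arc.\<close>
  define \<sigma> :: real where "\<sigma> = (if low = (m \<le> p) then - 1 else 1)"
  have g: "g l = \<sigma> * pairing \<nu> a \<alpha> \<beta> f"
    if f: "f \<in> admissible" and l: "\<And>t. (l has_real_derivative f t) (at t)" for l f
  proof -
    have cont: "continuous_on UNIV f" using f by (simp add: admissible_def)
    have ints: "integral {min p m..max p m} (\<lambda>t. l t * inner (\<gamma>' t) \<nu>)
        = - pairing \<nu> a (min p m) (max p m) f"
      using a a' pm by (intro pairing_by_parts[OF cont l]) (auto simp: min_def max_def)
    have "pairing \<nu> a (min p m) (max p m) f
        = (if low then 1 else - 1) * pairing \<nu> a \<alpha> \<beta> f"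
    proof (cases low)
      case True
      then show ?thesis by (simp add: low_def)
    next
      case False
      then have "\<alpha> = max p m" "\<beta> = min p m + 2 * pi" using or by (auto simp: low_def)
      moreover have "min p m \<le> max p m" "max p m \<le> min p m + 2 * pi" using pm by auto
      ultimately show ?thesis
        unfolding if_not_P[OF False]
        using pairing_complement[OF f, of "min p m" "max p m" \<nu> a] by simp
    qed
    moreover have "g l = (if m \<le> p then 1 else - 1) * integral {min p m..max p m} (\<lambda>t. l t * inner (\<gamma>' t) \<nu>)"
    proof (cases "m \<le> p")
      case True
      then have "min p m = m" "max p m = p" by auto
      with True show ?thesis by (simp add: g_def oint_def vector_derivative_at[OF deriv])
    next
      case False
      then have "min p m = p" "max p m = m" by auto
      with False show ?thesis by (simp add: g_def oint_def vector_derivative_at[OF deriv])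
    qed
    ultimately have "g l = (if m \<le> p then 1 else - 1) *
        (- ((if low then 1 else - 1) * pairing \<nu> a \<alpha> \<beta> f))"
      using ints by (simp only:)
    then show ?thesis
      unfolding \<sigma>_def by (cases "m \<le> p"; cases low) simp_all
  qed
  have \<sigma>: "\<sigma> = 1 \<or> \<sigma> = - 1" by (simp add: \<sigma>_def)
  have mult_admissible: "(\<lambda>t. \<sigma> * f t) \<in> admissible \<and> pairing \<nu> a \<alpha> \<beta> (\<lambda>t. \<sigma> * f t) = \<sigma> * pairing \<nu> a \<alpha> \<beta> f"
    if "f \<in> admissible" for f
    using \<sigma> that admissible_minus[OF that] by (auto simp: pairing_minus)
  have "g ` Lambda_star \<gamma> = pairing \<nu> a \<alpha> \<beta> ` admissible"
  proof (intro equalityI subsetI)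
    fix y assume "y \<in> g ` Lambda_star \<gamma>"
    then obtain l f where "f \<in> admissible" "y = g l" "\<And>t. (l has_real_derivative f t) (at t)"
      using Lambda_star_iff by auto
    then have "y = pairing \<nu> a \<alpha> \<beta> (\<lambda>t. \<sigma> * f t)" "(\<lambda>t. \<sigma> * f t) \<in> admissible"
      using g mult_admissible by auto
    then show "y \<in> pairing \<nu> a \<alpha> \<beta> ` admissible" by blast
  next
    fix y assume "y \<in> pairing \<nu> a \<alpha> \<beta> ` admissible"
    then obtain f where f: "f \<in> admissible" "y = pairing \<nu> a \<alpha> \<beta> f" by blast
    let ?f = "\<lambda>t. \<sigma> * f t"
    have f': "?f \<in> admissible" using mult_admissible f by blast
    then have "continuous_on UNIV ?f" by (simp add: admissible_def)
    then obtain l where "\<And>t. (l has_vector_derivative ?f t) (at t)"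
      using continuous_antiderivative by blast
    then have l: "\<And>t. (l has_real_derivative ?f t) (at t)"
      by (simp add: has_real_derivative_iff_has_vector_derivative)
    have "g l = \<sigma> * (\<sigma> * pairing \<nu> a \<alpha> \<beta> f)"
      unfolding g[OF f' l] conjunct2[OF mult_admissible[OF f(1)]] ..
    then have "g l = y" using \<sigma> f(2) by (elim disjE) simp_all
    moreover have "l \<in> Lambda_star \<gamma>"
      unfolding Lambda_star_iff using f' by (rule bexI[rotated]) (rule allI l)+
    ultimately show "y \<in> g ` Lambda_star \<gamma>" by blast
  qed
  moreover have "cENT N \<gamma> zp zm = Sup (g ` Lambda_star \<gamma>)"
    by (simp add: cENT_def Let_def \<nu> g_def p_def m_def)
  ultimately show ?thesis using that[OF cap \<alpha>\<beta>(5)] by simp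
qed

lemma pairing_le_cap_area:
  assumes cap: "cap \<nu> a \<alpha> \<beta>" and f: "f \<in> admissible"
  shows "pairing \<nu> a \<alpha> \<beta> f \<le> cap_area \<nu> a \<alpha> \<beta>"
  unfolding pairing_def cap_area_def
proof (rule integral_le)
  have "continuous_on S f" for S
    using f by (auto simp: admissible_def intro: continuous_on_subset)
  then show "(\<lambda>t. f t * height \<nu> a t) integrable_on {\<alpha>..\<beta>}" "height \<nu> a integrable_on {\<alpha>..\<beta>}"
    by (intro integrable_continuous_real continuous_intros height_continuous; simp)+
  fix t assume t: "t \<in> {\<alpha>..\<beta>}"
  have "f t \<le> 1" using f by (auto simp: admissible_def abs_le_iff)
  then have "f t * height \<nu> a t \<le> 1 * height \<nu> a t"
    by (intro mult_right_mono cap_height(1)[OF cap t])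
  then show "f t * height \<nu> a t \<le> height \<nu> a t" by simp
qed

lemma bdd_above_pairing: "cap \<nu> a \<alpha> \<beta> \<Longrightarrow> bdd_above (pairing \<nu> a \<alpha> \<beta> ` admissible)"
  using pairing_le_cap_area by (intro bdd_aboveI2) blast

lemma Sup_pairing_le_cap_area:
  assumes "cap \<nu> a \<alpha> \<beta>"
  shows "Sup (pairing \<nu> a \<alpha> \<beta> ` admissible) \<le> cap_area \<nu> a \<alpha> \<beta>"
proof (rule cSup_least)
  have "(\<lambda>_. 0) \<in> admissible" by (simp add: admissible_def)
  then show "pairing \<nu> a \<alpha> \<beta> ` admissible \<noteq> {}" by blast
qed (use pairing_le_cap_area[OF assms] in blast)

text \<open>As \<open>a \<ge> 0\<close>, the boundary point in direction \<open>- \<nu>\<close> lies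
  at least \<open>1 / K\<close> below the chord. The height is 1-Lipschitz and vanishes at the ends,
  so that point is at parameter distance at least \<open>1 / K\<close> from both.\<close>

lemma cap_gap:
  assumes cap: "cap \<nu> a \<alpha> \<beta>"
  obtains s where "s \<in> {0..4 * pi}" "\<beta> + 1 / K \<le> s" "s + 1 / K \<le> \<alpha> + 2 * pi"
proof -
  have \<nu>: "cmod \<nu> = 1" and a: "a \<ge> 0" using cap by (auto simp: cap_def)
  have "N (- \<nu> / of_real (N (- \<nu>))) = 1" "inner (- \<nu> / of_real (N (- \<nu>))) (- \<nu>) \<ge> 1 / K"
    using point_in_direction[of "- \<nu>"] \<nu> by auto
  then obtain s where s: "\<alpha> \<le> s" "s < \<alpha> + 2 * pi" "inner (\<gamma> s) (- \<nu>) \<ge> 1 / K"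
    using curve_onto[of "- \<nu> / of_real (N (- \<nu>))" \<alpha>] by metis
  have hs: "height \<nu> a s \<le> - (1 / K)" using s(3) a by (simp add: height_def)
  have "1 / K > 0" using K by simp
  then have "s \<notin> {\<alpha>..\<beta>}" using cap_height(1)[OF cap, of s] hs by linarith
  then have "s > \<beta>" using s by auto
  moreover have "height \<nu> a (\<alpha> + 2 * pi) = 0" using cap_height[OF cap] height_periodic by simp
  ultimately show ?thesis
    using that[of s] hs height_lipschitz[OF \<nu>, of a s \<beta>] height_lipschitz[OF \<nu>, of a s "\<alpha> + 2 * pi"]
      s cap_height[OF cap] cap by (auto simp: cap_def)
qed

text \<open>The test function is close to the indicator of the cap, corrected outside the cap so that
  its moments against \<open>1\<close> and \<open>\<gamma>\<close> vanish.\<close>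

lemma cap_area_le_Sup_pairing:
  obtains C where "C > 0"
    "\<And>\<nu> a \<alpha> \<beta>. cap \<nu> a \<alpha> \<beta> \<Longrightarrow> cap_area \<nu> a \<alpha> \<beta> \<le> C * Sup (pairing \<nu> a \<alpha> \<beta> ` admissible)"
proof -
  \<comment> \<open>Half the margin of \<open>cap_gap\<close>: one half allows moving the centre to
    the grid, the other is the radius of the correcting arc.\<close>
  define \<rho> where "\<rho> = 1 / (2 * K)"
  have \<rho>: "0 < \<rho>" "\<rho> < pi" "1 / K = 2 * \<rho>"
  proof -
    have "1 / (2 * K) \<le> 1 / 2" using K by (simp add: field_simps)
    then show "\<rho> < pi" using pi_gt3 by (simp add: \<rho>_def)
  qed (use K in \<open>auto simp: \<rho>_def\<close>)
  obtain C0 where C0: "C0 > 0"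
    "\<And>s. s \<in> {0..4 * pi} \<Longrightarrow> \<exists>c. \<bar>c - s\<bar> \<le> \<rho> \<and> (\<forall>m. \<exists>x. norm x \<le> C0 * norm m \<and> moment \<rho> c x = m)"
    using moment_inverse_uniform[OF \<rho>(1,2)] by blast
  \<comment> \<open>The \<open>1\<close> bounds \<open>\<psi>\<close>. The rest bounds the
    correction \<open>w\<close>: \<open>2\<close> for the bump,
    \<open>C0 * (2 * pi * (1 + R))\<close> for the solution \<open>x\<close> of the moment problem,
    and \<open>1 + R\<close> for \<open>(1, \<gamma> t)\<close>.\<close>
  define C where "C = 1 + 2 * (C0 * (2 * pi * (1 + R))) * (1 + R)"
  have C: "C \<ge> 1" using C0 R by (simp add: C_def)
  have norm_1\<gamma>: "norm (1 :: real, \<gamma> t) \<le> 1 + R" for t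
    using norm_Pair_le[of "1 :: real" "\<gamma> t"] norm_curve_le[of t] by simp
  have "cap_area \<nu> a \<alpha> \<beta> \<le> C * Sup (pairing \<nu> a \<alpha> \<beta> ` admissible)" if cap: "cap \<nu> a \<alpha> \<beta>" for \<nu> a \<alpha> \<beta>
  proof (rule field_le_epsilon)
    fix e :: real assume e: "e > 0"
    define \<epsilon> where "\<epsilon> = e / (2 * pi)"
    have \<epsilon>: "\<epsilon> > 0" using e by (simp add: \<epsilon>_def)
    let ?h = "height \<nu> a"
    \<comment> \<open>A continuous substitute for the indicator of the cap: zero where the height is
      not positive, and tending to \<open>1\<close> elsewhere as \<open>\<epsilon>\<close>
      shrinks.\<close>
    define \<psi> where "\<psi> = (\<lambda>t. max 0 (?h t) / (max 0 (?h t) + \<epsilon>))"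
    have \<psi>_cont: "continuous_on S \<psi>" for S
      unfolding \<psi>_def using \<epsilon> by (intro continuous_intros height_continuous) (auto simp: add_nonneg_eq_0_iff)
    have \<psi>_bd: "0 \<le> \<psi> t" "\<psi> t \<le> 1" for t
      using \<epsilon> by (auto simp: \<psi>_def divide_le_eq_1)
    have \<psi>_per: "\<psi> (t + 2 * pi) = \<psi> t" for t by (simp add: \<psi>_def height_periodic)
    obtain s where s: "s \<in> {0..4 * pi}" "\<beta> + 1 / K \<le> s" "s + 1 / K \<le> \<alpha> + 2 * pi"
      using cap_gap[OF cap] by blast
    obtain c where c: "\<bar>c - s\<bar> \<le> \<rho>" "\<And>m. \<exists>x. norm x \<le> C0 * norm m \<and> moment \<rho> c x = m"
      using C0(2)[OF s(1)] by blast
    define m where "m = integral {0..2 * pi} (\<lambda>t. \<psi> t *\<^sub>R (1 :: real, \<gamma> t))"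
    have m: "norm m \<le> (1 + R) * (2 * pi - 0)"
      unfolding m_def
    proof (rule integral_bound)
      fix t
      have "\<psi> t * norm (1 :: real, \<gamma> t) \<le> 1 * (1 + R)"
        using \<psi>_bd norm_1\<gamma> by (intro mult_mono) auto
      then show "norm (\<psi> t *\<^sub>R (1 :: real, \<gamma> t)) \<le> 1 + R"
        unfolding norm_scaleR using \<psi>_bd by simp
    qed (auto intro!: continuous_intros \<psi>_cont curve_continuous)
    obtain x where x: "norm x \<le> C0 * norm m" "moment \<rho> c x = m" using c(2) by blast
    define w where "w = (\<lambda>t. bump \<rho> c t * inner x (1, \<gamma> t))"
    have w_cont: "continuous_on S w" for S
      unfolding w_def by (intro continuous_intros bump_props curve_continuous)
    have w_per: "w (t + 2 * pi) = w t" for t by (simp add: w_def bump_props periodic)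
    have w_bd: "\<bar>w t\<bar> \<le> C - 1" for t
    proof -
      have "\<bar>inner x (1, \<gamma> t)\<bar> \<le> norm x * norm (1 :: real, \<gamma> t)" by (rule Cauchy_Schwarz_ineq2)
      also have "\<dots> \<le> (C0 * (2 * pi * (1 + R))) * (1 + R)"
      proof (rule mult_mono)
        have "norm x \<le> C0 * ((1 + R) * (2 * pi - 0))"
          using x(1) m C0(1) by (meson mult_left_mono less_imp_le order_trans)
        then show "norm x \<le> C0 * (2 * pi * (1 + R))" by (simp add: mult_ac)
      qed (use norm_1\<gamma> C0 R in auto)
      finally have "bump \<rho> c t * \<bar>inner x (1, \<gamma> t)\<bar> \<le> 2 * ((C0 * (2 * pi * (1 + R))) * (1 + R))"
        using bump_props(3,4) by (intro mult_mono) auto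
      then show ?thesis using bump_props(3)[of \<rho> c t] by (simp add: w_def C_def abs_mult)
    qed
    have w_zero: "w t = 0" if t: "t \<in> {\<alpha>..\<beta>}" for t
    proof -
      \<comment> \<open>The centre \<open>c\<close> is at distance at most \<open>\<rho>\<close>
        from \<open>s\<close>, hence still at least \<open>\<rho>\<close> away from both ends of the
        cap, so \<open>\<rho> \<le> c - t \<le> 2 * pi - \<rho>\<close>.\<close>
      have "cos (c - t) \<le> cos \<rho>" using \<rho> s c(1) t by (intro cos_le_cos_of_mem) auto
      moreover have "cos (c - t) = cos (t - c)" using cos_minus[of "c - t"] by simp
      ultimately show ?thesis by (simp add: w_def bump_def)
    qed
    define f where "f = (\<lambda>t. (\<psi> t - w t) / C)"
    have "integral {0..2 * pi} (\<lambda>t. f t *\<^sub>R (1 :: real, \<gamma> t))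
        = integral {0..2 * pi} (\<lambda>t. (1 / C) *\<^sub>R (\<psi> t *\<^sub>R (1, \<gamma> t) - w t *\<^sub>R (1, \<gamma> t)))"
      by (simp add: f_def algebra_simps diff_divide_distrib)
    also have "\<dots> = (1 / C) *\<^sub>R (m - moment \<rho> c x)"
      unfolding m_def moment_def w_def[symmetric]
      by (subst integral_cmul, subst integral_diff)
        (auto intro!: integrable_continuous_real continuous_intros \<psi>_cont w_cont curve_continuous
          bump_props(1) simp: w_def)
    finally have mom: "integral {0..2 * pi} (\<lambda>t. f t *\<^sub>R (1 :: real, \<gamma> t)) = 0" using x by simp
    have f_cont: "continuous_on S f" for S
      unfolding f_def using C by (intro continuous_intros \<psi>_cont w_cont) auto
    have int: "(\<lambda>t. f t *\<^sub>R (1 :: real, \<gamma> t)) integrable_on {0..2 * pi}"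
      by (intro integrable_continuous_real continuous_intros f_cont curve_continuous)
    have "integral {0..2 * pi} f = fst (integral {0..2 * pi} (\<lambda>t. f t *\<^sub>R (1 :: real, \<gamma> t)))"
      using integral_linear[OF int bounded_linear_fst] by (simp add: o_def)
    moreover have "integral {0..2 * pi} (\<lambda>t. f t *\<^sub>R \<gamma> t) = snd (integral {0..2 * pi} (\<lambda>t. f t *\<^sub>R (1 :: real, \<gamma> t)))"
      using integral_linear[OF int bounded_linear_snd] by (simp add: o_def)
    moreover have "\<bar>f t\<bar> \<le> 1" for t
    proof -
      have "\<bar>\<psi> t - w t\<bar> \<le> C" using \<psi>_bd[of t] w_bd[of t] by linarith
      then show ?thesis using C by (simp add: f_def)
    qed
    ultimately have f: "f \<in> admissible"
      using f_cont mom \<psi>_per w_per by (simp add: admissible_def f_def)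
    have "cap_area \<nu> a \<alpha> \<beta> - \<epsilon> * (\<beta> - \<alpha>) = integral {\<alpha>..\<beta>} (\<lambda>t. ?h t - \<epsilon>)"
      unfolding cap_area_def using cap
      by (subst integral_diff) (auto intro!: integrable_continuous_real height_continuous simp: cap_def)
    also have "\<dots> \<le> integral {\<alpha>..\<beta>} (\<lambda>t. C * (f t * ?h t))"
    proof (rule integral_le)
      fix t assume t: "t \<in> {\<alpha>..\<beta>}"
      have h: "?h t \<ge> 0" by (rule cap_height(1)[OF cap t])
      have "(?h t - \<epsilon>) * (?h t + \<epsilon>) \<le> ?h t * ?h t" by (simp add: algebra_simps)
      then have "?h t - \<epsilon> \<le> ?h t / (?h t + \<epsilon>) * ?h t"
        using h \<epsilon> by (simp add: pos_le_divide_eq)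
      then show "?h t - \<epsilon> \<le> C * (f t * ?h t)"
        using C h w_zero[OF t] by (simp add: f_def \<psi>_def)
    qed (auto intro!: integrable_continuous_real continuous_intros f_cont height_continuous)
    also have "\<dots> = C * pairing \<nu> a \<alpha> \<beta> f" by (simp add: pairing_def)
    also have "\<dots> \<le> C * Sup (pairing \<nu> a \<alpha> \<beta> ` admissible)"
      using C f bdd_above_pairing[OF cap] by (intro mult_left_mono cSup_upper) auto
    finally have 1: "cap_area \<nu> a \<alpha> \<beta> - \<epsilon> * (\<beta> - \<alpha>) \<le> C * Sup (pairing \<nu> a \<alpha> \<beta> ` admissible)" .
    have "\<epsilon> * (\<beta> - \<alpha>) \<le> \<epsilon> * (2 * pi)" using \<epsilon> cap by (intro mult_left_mono) (auto simp: cap_def)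
    also have "\<dots> = e" by (simp add: \<epsilon>_def)
    finally show "cap_area \<nu> a \<alpha> \<beta> \<le> C * Sup (pairing \<nu> a \<alpha> \<beta> ` admissible) + e" using 1 by linarith
  qed
  then show ?thesis using that[of C] C by auto
qed

subsection \<open>The one-dimensional cost\<close>

definition profile :: "complex \<Rightarrow> real \<Rightarrow> real \<Rightarrow> real" where
  "profile \<nu> a s = 1 - (N (of_real a * \<nu> + of_real s * (\<i> * \<nu>)))\<^sup>2"

lemma profile_continuous: "continuous_on S (profile \<nu> a)"
  unfolding profile_def by (intro continuous_intros continuous_on_compose2[OF N_continuous]) auto

lemma c1D_eq:
  assumes "zp \<noteq> zm" "\<nu> = nu_vec zp zm" "a = inner zp \<nu>"
  shows "c1D N zp zm = 2 * \<bar>integral {inner zp (\<i> * \<nu>)..inner zm (\<i> * \<nu>)} (profile \<nu> a)\<bar>"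
  using inner_nu_vec_less[OF assms(1)] assms(2,3)
  by (simp add: c1D_def Let_def oint_def profile_def[abs_def])

lemma cap_area_nonneg: "cap \<nu> a \<alpha> \<beta> \<Longrightarrow> cap_area \<nu> a \<alpha> \<beta> \<ge> 0"
  unfolding cap_area_def
  by (intro integral_nonneg integrable_continuous_real height_continuous cap_height(1))

text \<open>Central projection of the cap onto its chord turns the chord integral into an integral
  over the cap, with density explicitly comparable to the height.\<close>

lemma chord_integral_far:
  assumes cap: "cap \<nu> a \<alpha> \<beta>" and a: "a \<ge> 1 / (2 * K)"
    and z: "{\<gamma> \<alpha>, \<gamma> \<beta>} = {zp, zm}" and less: "inner zp (\<i> * \<nu>) < inner zm (\<i> * \<nu>)"
  defines "J \<equiv> \<bar>integral {inner zp (\<i> * \<nu>)..inner zm (\<i> * \<nu>)} (profile \<nu> a)\<bar>"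
  shows "cap_area \<nu> a \<alpha> \<beta> / (2 * K\<^sup>2 * R ^ 3) \<le> J" "J \<le> 8 * R * K\<^sup>2 * cap_area \<nu> a \<alpha> \<beta>"
proof -
  have \<nu>: "cmod \<nu> = 1" and ab: "\<alpha> < \<beta>" using cap by (auto simp: cap_def)
  have K0: "K > 0" "R > 0" using K R by auto
  have "1 / (2 * K) > 0" using K0 by simp
  then have a0: "a > 0" using a by linarith
  let ?h = "height \<nu> a"
  define p where "p = (\<lambda>t. inner (\<gamma> t) \<nu>)"
  define q where "q = (\<lambda>t. inner (\<gamma> t) (\<i> * \<nu>))"
  define d where "d = (\<lambda>t. Im (cnj (\<gamma> t) * \<gamma>' t))"
  \<comment> \<open>Chord coordinate of the point where the ray through \<open>\<gamma> t\<close>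
    meets the line at height \<open>a\<close>.\<close>
  define \<sigma> where "\<sigma> = (\<lambda>t. a * q t / p t)"
  \<comment> \<open>By the quotient rule the numerator is \<open>a\<close> times the determinant of
    \<open>\<gamma> t\<close> and \<open>\<gamma>' t\<close>.\<close>
  define \<sigma>' where "\<sigma>' = (\<lambda>t. a * d t / (p t)\<^sup>2)"
  have h: "p t = a + ?h t" for t by (simp add: p_def height_def)
  have h0: "?h t \<ge> 0" if "t \<in> {\<alpha>..\<beta>}" for t using cap_height(1)[OF cap that] .
  have p: "p t \<ge> a" "p t > 0" if "t \<in> {\<alpha>..\<beta>}" for t using h0[OF that] h[of t] a0 by auto
  have pR: "\<bar>p t\<bar> \<le> R" "\<bar>q t\<bar> \<le> R" for t
    using Cauchy_Schwarz_ineq2[of "\<gamma> t" \<nu>] Cauchy_Schwarz_ineq2[of "\<gamma> t" "\<i> * \<nu>"] norm_curve_le[of t] \<nu>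
    by (auto simp: p_def q_def norm_mult)
  have d: "\<bar>d t\<bar> \<ge> 1 / K" "\<bar>d t\<bar> \<le> R" for t using det det_le by (auto simp: d_def)
  have deriv_\<sigma>: "(\<sigma> has_real_derivative \<sigma>' t) (at t)" if t: "t \<in> {\<alpha>..\<beta>}" for t
  proof -
    have dp: "(p has_real_derivative inner (\<gamma>' t) \<nu>) (at t)"
      and dq: "(q has_real_derivative inner (\<gamma>' t) (\<i> * \<nu>)) (at t)"
      unfolding p_def q_def has_real_derivative_iff_has_vector_derivative
      by (rule bounded_linear.has_vector_derivative[OF bounded_linear_inner_left deriv])+
    have "p t * inner (\<gamma>' t) (\<i> * \<nu>) - q t * inner (\<gamma>' t) \<nu> = d t"
      unfolding p_def q_def d_def by (rule det_frame[OF \<nu>])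
    then have "a * inner (\<gamma>' t) (\<i> * \<nu>) * p t - a * q t * inner (\<gamma>' t) \<nu> = a * d t"
      by (metis (no_types, opaque_lifting) mult.assoc mult.commute right_diff_distrib)
    moreover have "(\<sigma> has_real_derivative
        (a * inner (\<gamma>' t) (\<i> * \<nu>) * p t - a * q t * inner (\<gamma>' t) \<nu>) / (p t * p t)) (at t)"
      unfolding \<sigma>_def using p(2)[OF t] by (intro DERIV_divide DERIV_cmult dp dq) auto
    ultimately show ?thesis by (simp add: \<sigma>'_def power2_eq_square)
  qed
  have \<sigma>_range: "\<sigma> ` {\<alpha>..\<beta>} \<subseteq> {-R..R}"
  proof safe
    fix t assume t: "t \<in> {\<alpha>..\<beta>}"
    have "\<bar>\<sigma> t\<bar> = \<bar>q t\<bar> * (a / p t)" using a0 p[OF t] by (simp add: \<sigma>_def abs_mult)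
    also have "\<dots> \<le> R * 1" using a0 p[OF t] pR K0 by (intro mult_mono) auto
    finally show "\<sigma> t \<in> {-R..R}" by (simp add: abs_le_iff)
  qed
  \<comment> \<open>The orientation is not known yet, so the oriented integral is written as a
    difference of two, at least one of which is over a trivial interval.\<close>
  have sub: "((\<lambda>t. \<sigma>' t *\<^sub>R profile \<nu> a (\<sigma> t)) has_integral
      (integral {\<sigma> \<alpha>..\<sigma> \<beta>} (profile \<nu> a) - integral {\<sigma> \<beta>..\<sigma> \<alpha>} (profile \<nu> a))) {\<alpha>..\<beta>}"
  proof (rule has_integral_substitution_general[OF finite.emptyI less_imp_le[OF ab] \<sigma>_range profile_continuous])
    show "continuous_on {\<alpha>..\<beta>} \<sigma>"
      using deriv_\<sigma> by (intro continuous_at_imp_continuous_on ballI DERIV_isCont)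
  qed (use deriv_\<sigma> in \<open>auto intro: has_field_derivative_at_within\<close>)
  have "\<sigma> \<alpha> = q \<alpha>" "\<sigma> \<beta> = q \<beta>" using cap a0 by (auto simp: \<sigma>_def p_def cap_def)
  then have J: "J = \<bar>integral {\<sigma> \<alpha>..\<sigma> \<beta>} (profile \<nu> a) - integral {\<sigma> \<beta>..\<sigma> \<alpha>} (profile \<nu> a)\<bar>"
    using z less unfolding J_def q_def by (auto simp: doubleton_eq_iff)
  have \<sigma>'_abs: "\<bar>\<sigma>' t\<bar> = a * \<bar>d t\<bar> / (p t)\<^sup>2" for t using a0 by (simp add: \<sigma>'_def abs_mult)
  have nz: "\<sigma>' t \<noteq> 0" if t: "t \<in> {\<alpha>..\<beta>}" for t
  proof -
    have "1 / K > 0" using K0 by simp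
    then have "d t \<noteq> 0" using d(1)[of t] by linarith
    then show ?thesis using a0 p[OF t] by (simp add: \<sigma>'_def)
  qed
  have "(\<forall>t\<in>{\<alpha><..<\<beta>}. \<sigma>' t > 0) \<or> (\<forall>t\<in>{\<alpha><..<\<beta>}. \<sigma>' t < 0)"
    by (rule derivative_nonzero_imp_signed[OF deriv_\<sigma> nz])
  then obtain \<epsilon> :: real where \<epsilon>: "\<bar>\<epsilon>\<bar> = 1" "\<And>t. t \<in> {\<alpha><..<\<beta>} \<Longrightarrow> \<epsilon> * \<sigma>' t = \<bar>\<sigma>' t\<bar>"
  proof
    assume "\<forall>t\<in>{\<alpha><..<\<beta>}. \<sigma>' t > 0"
    then show thesis by (intro that[of 1]) (simp_all add: abs_of_pos)
  next
    assume "\<forall>t\<in>{\<alpha><..<\<beta>}. \<sigma>' t < 0"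
    then show thesis by (intro that[of "-1"]) (simp_all add: abs_of_neg)
  qed
  define I where "I = \<epsilon> * (integral {\<sigma> \<alpha>..\<sigma> \<beta>} (profile \<nu> a) - integral {\<sigma> \<beta>..\<sigma> \<alpha>} (profile \<nu> a))"
  have JI: "J = \<bar>I\<bar>" using \<epsilon>(1) by (simp add: J I_def abs_mult)
  have "((\<lambda>t. \<epsilon> * (\<sigma>' t *\<^sub>R profile \<nu> a (\<sigma> t))) has_integral I) {\<alpha>..\<beta>}"
    unfolding I_def by (rule has_integral_mult_right[OF sub])
  \<comment> \<open>The sign of \<open>\<sigma>'\<close> is known in the interior only, so the
    endpoints are dropped.\<close>
  then have I: "((\<lambda>t. \<epsilon> * (\<sigma>' t *\<^sub>R profile \<nu> a (\<sigma> t))) has_integral I) {\<alpha><..<\<beta>}"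
    by (simp only: has_integral_Icc_iff_Ioo)
  have "?h integrable_on {\<alpha>..\<beta>}" by (intro integrable_continuous_real height_continuous)
  then have A: "(?h has_integral cap_area \<nu> a \<alpha> \<beta>) {\<alpha><..<\<beta>}"
    unfolding cap_area_def has_integral_Icc_iff_Ioo[symmetric] by (rule integrable_integral)
  \<comment> \<open>By homogeneity \<open>N\<close> equals \<open>a / p t\<close> at the projected
    point, so the profile there is \<open>1 - (a / p t)\<^sup>2\<close>, which has the height as a
    factor.\<close>
  have integrand: "\<epsilon> * (\<sigma>' t *\<^sub>R profile \<nu> a (\<sigma> t)) = (a * \<bar>d t\<bar> * (2 * a + ?h t) / p t ^ 4) * ?h t"
    if t: "t \<in> {\<alpha><..<\<beta>}" for t
  proof -
    have pt: "p t > 0" using p(2)[of t] t by simp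
    have "of_real a * \<nu> + of_real (\<sigma> t) * (\<i> * \<nu>) = of_real (a / p t) * (of_real (p t) * \<nu> + of_real (q t) * (\<i> * \<nu>))"
      using pt by (simp add: \<sigma>_def field_simps)
    also have "of_real (p t) * \<nu> + of_real (q t) * (\<i> * \<nu>) = \<gamma> t"
      unfolding p_def q_def using complex_eq_by_frame[OF \<nu>] by simp
    finally have "N (of_real a * \<nu> + of_real (\<sigma> t) * (\<i> * \<nu>)) = a / p t"
      using homogeneous[of "a / p t" "\<gamma> t"] a0 pt by simp
    then have "profile \<nu> a (\<sigma> t) = 1 - (a / p t)\<^sup>2" by (simp add: profile_def)
    also have "\<dots> = ((p t)\<^sup>2 - a\<^sup>2) / (p t)\<^sup>2" using pt by (simp add: power_divide diff_divide_distrib)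
    also have "(p t)\<^sup>2 - a\<^sup>2 = (2 * a + ?h t) * ?h t"
      by (simp add: h power2_eq_square algebra_simps)
    finally have "profile \<nu> a (\<sigma> t) = (2 * a + ?h t) * ?h t / (p t)\<^sup>2" .
    then have "\<epsilon> * (\<sigma>' t *\<^sub>R profile \<nu> a (\<sigma> t)) = (a * \<bar>d t\<bar> / (p t)\<^sup>2) * ((2 * a + ?h t) * ?h t / (p t)\<^sup>2)"
      using \<epsilon>(2)[OF t] \<sigma>'_abs[of t] by (simp only: real_scaleR_def mult.assoc[symmetric])
    also have "\<dots> = (a * \<bar>d t\<bar> * (2 * a + ?h t) / p t ^ 4) * ?h t"
      by (simp add: power2_eq_square power4_eq_xxxx)
    finally show ?thesis .
  qed
  \<comment> \<open>Both bounds on the density use \<open>a \<ge> 1 / (2 * K)\<close> and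
    \<open>a \<le> p t\<close>; here also \<open>p t \<le> R\<close> and the lower bound on the
    determinant.\<close>
  have low: "1 / (2 * K\<^sup>2 * R ^ 3) \<le> a * \<bar>d t\<bar> * (2 * a + ?h t) / p t ^ 4" if t: "t \<in> {\<alpha>..\<beta>}" for t
  proof -
    have "1 / (2 * K\<^sup>2 * R ^ 3) = (1 / (2 * K)) * (1 / K) / R ^ 3"
      by (simp add: power2_eq_square)
    also have "\<dots> \<le> a * \<bar>d t\<bar> / p t ^ 3"
      using a d(1)[of t] p[OF t] pR[of t] a0 K0 by (intro frac_le mult_mono power_mono) auto
    also have "\<dots> = a * \<bar>d t\<bar> * p t / p t ^ 4"
      using p[OF t] by (simp add: power4_eq_xxxx power3_eq_cube)
    also have "\<dots> \<le> a * \<bar>d t\<bar> * (2 * a + ?h t) / p t ^ 4"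
      using a0 p[OF t] by (intro divide_right_mono mult_left_mono) (auto simp: h)
    finally show ?thesis .
  qed
  have up: "a * \<bar>d t\<bar> * (2 * a + ?h t) / p t ^ 4 \<le> 8 * R * K\<^sup>2" if t: "t \<in> {\<alpha>..\<beta>}" for t
  proof -
    have "a * \<bar>d t\<bar> * (2 * a + ?h t) / p t ^ 4 \<le> p t * R * (2 * p t) / p t ^ 4"
      using a0 p[OF t] d(2)[of t] h0[OF t] K0 by (intro divide_right_mono mult_mono) (auto simp: h)
    also have "\<dots> = 2 * R / (p t)\<^sup>2"
      using p[OF t] by (simp add: power4_eq_xxxx power2_eq_square)
    also have "\<dots> \<le> 2 * R / (1 / (2 * K))\<^sup>2"
      using a p[OF t] K0 by (intro divide_left_mono power_mono) auto
    also have "\<dots> = 8 * R * K\<^sup>2" using K0 by (simp add: field_simps power2_eq_square)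
    finally show ?thesis .
  qed
  have "1 / (2 * K\<^sup>2 * R ^ 3) * cap_area \<nu> a \<alpha> \<beta> \<le> I"
  proof (rule has_integral_le[OF has_integral_mult_right[OF A] I])
    fix t assume t: "t \<in> {\<alpha><..<\<beta>}"
    show "1 / (2 * K\<^sup>2 * R ^ 3) * ?h t \<le> \<epsilon> * (\<sigma>' t *\<^sub>R profile \<nu> a (\<sigma> t))"
      unfolding integrand[OF t] using t low[of t] h0[of t] by (intro mult_right_mono) auto
  qed
  then show "cap_area \<nu> a \<alpha> \<beta> / (2 * K\<^sup>2 * R ^ 3) \<le> J" by (simp add: JI)
  have "I \<le> 8 * R * K\<^sup>2 * cap_area \<nu> a \<alpha> \<beta>"
  proof (rule has_integral_le[OF I has_integral_mult_right[OF A]])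
    fix t assume t: "t \<in> {\<alpha><..<\<beta>}"
    show "\<epsilon> * (\<sigma>' t *\<^sub>R profile \<nu> a (\<sigma> t)) \<le> 8 * R * K\<^sup>2 * ?h t"
      unfolding integrand[OF t] using t up[of t] h0[of t] by (intro mult_right_mono) auto
  qed
  moreover have "I \<ge> 0"
  proof (rule has_integral_nonneg[OF I])
    fix t assume t: "t \<in> {\<alpha><..<\<beta>}"
    show "0 \<le> \<epsilon> * (\<sigma>' t *\<^sub>R profile \<nu> a (\<sigma> t))"
      unfolding integrand[OF t] using t a0 h0[of t] p[of t] by (intro mult_nonneg_nonneg divide_nonneg_nonneg) auto
  qed
  ultimately show "J \<le> 8 * R * K\<^sup>2 * cap_area \<nu> a \<alpha> \<beta>" by (simp add: JI)
qed

section \<open>Chords close to the origin\<close>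

lemma N_convex:
  assumes "0 \<le> \<tau>" "\<tau> \<le> 1"
  shows "N (of_real (1 - \<tau>) * x + of_real \<tau> * y) \<le> (1 - \<tau>) * N x + \<tau> * N y"
  using triangle[of "of_real (1 - \<tau>) * x" "of_real \<tau> * y"] homogeneous[of "1 - \<tau>" x] homogeneous[of \<tau> y] assms
  by simp

text \<open>The boundary point in direction \<open>\<nu>\<close> is at least
  \<open>1 / K - 1 / (2 * K)\<close>, that is \<open>2 * \<delta>\<close>, above the chord. By the
  Lipschitz bound the height stays above \<open>\<delta>\<close> on an interval of length
  \<open>\<delta>\<close> inside the cap.\<close>

lemma cap_area_near:
  assumes cap: "cap \<nu> a \<alpha> \<beta>" and a: "a < 1 / (2 * K)"
  shows "(1 / (4 * K))\<^sup>2 \<le> cap_area \<nu> a \<alpha> \<beta>" "cap_area \<nu> a \<alpha> \<beta> \<le> 2 * pi * R"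
proof -
  have \<nu>: "cmod \<nu> = 1" and ab: "\<alpha> < \<beta>" "\<beta> < \<alpha> + 2 * pi" and a0: "a \<ge> 0"
    using cap by (auto simp: cap_def)
  let ?h = "height \<nu> a"
  have int: "?h integrable_on {s..t}" for s t by (intro integrable_continuous_real height_continuous)
  have "cap_area \<nu> a \<alpha> \<beta> \<le> integral {\<alpha>..\<beta>} (\<lambda>_. R)"
    unfolding cap_area_def
  proof (rule integral_le[OF int])
    fix t
    show "?h t \<le> R"
      using Cauchy_Schwarz_ineq2[of "\<gamma> t" \<nu>] norm_curve_le[of t] \<nu> a0 by (simp add: height_def abs_le_iff)
  qed (rule integrable_const_ivl)
  also have "\<dots> = (\<beta> - \<alpha>) * R" using ab by simp
  also have "\<dots> \<le> 2 * pi * R" using ab R by (intro mult_right_mono) auto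
  finally show "cap_area \<nu> a \<alpha> \<beta> \<le> 2 * pi * R" .
  define \<delta> where "\<delta> = 1 / (4 * K)"
  have \<delta>: "\<delta> > 0" "1 / K = 4 * \<delta>" "1 / (2 * K) = 2 * \<delta>" using K by (auto simp: \<delta>_def)
  obtain s where s: "\<alpha> \<le> s" "s < \<alpha> + 2 * pi" "\<gamma> s = \<nu> / of_real (N \<nu>)"
    using curve_onto[OF point_in_direction(1)[OF \<nu>]] by metis
  have hs: "?h s \<ge> 2 * \<delta>"
    using point_in_direction(2)[OF \<nu>] a \<delta> s(3) by (simp add: height_def)
  have "?h t \<le> 0" if "t \<in> {\<beta>..<\<alpha> + 2 * pi}" for t
    using that cap by (cases "t = \<beta>") (auto simp: cap_def height_def less_imp_le)
  then have "s < \<beta>" using hs \<delta> s by (metis atLeastLessThan_iff not_less mult_pos_pos order_trans zero_less_numeral)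
  moreover have "s - \<alpha> \<ge> 2 * \<delta>"
    using height_lipschitz[OF \<nu>, of a s \<alpha>] cap_height(2)[OF cap] hs s by simp
  ultimately have sub: "{s - \<delta>..s} \<subseteq> {\<alpha>..\<beta>}" using \<delta> by auto
  have "\<delta>\<^sup>2 = integral {s - \<delta>..s} (\<lambda>_. \<delta>)" using \<delta> by (simp add: power2_eq_square)
  also have "\<dots> \<le> integral {s - \<delta>..s} ?h"
  proof (rule integral_le[OF _ int])
    fix t assume "t \<in> {s - \<delta>..s}"
    then show "\<delta> \<le> ?h t" using height_lipschitz[OF \<nu>, of a s t] hs by auto
  qed (rule integrable_const_ivl)
  also have "\<dots> \<le> cap_area \<nu> a \<alpha> \<beta>"
    unfolding cap_area_def using sub cap_height(1)[OF cap] by (intro integral_subset_le int) auto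
  finally show "(1 / (4 * K))\<^sup>2 \<le> cap_area \<nu> a \<alpha> \<beta>" by (simp add: \<delta>_def)
qed

text \<open>The foot \<open>P 0\<close> of the perpendicular from the origin satisfies
  \<open>N (P 0) < 1 / 2\<close>, so the chord contains a segment of definite length on which
  \<open>N\<close> stays below \<open>3 / 4\<close>.\<close>

lemma chord_integral_near:
  assumes \<nu>: "cmod \<nu> = 1" and a: "0 \<le> a" "a < 1 / (2 * K)"
    and z: "N zp = 1" "N zm = 1" "inner zp \<nu> = a" "inner zm \<nu> = a"
    and less: "inner zp (\<i> * \<nu>) < inner zm (\<i> * \<nu>)"
  defines "J \<equiv> \<bar>integral {inner zp (\<i> * \<nu>)..inner zm (\<i> * \<nu>)} (profile \<nu> a)\<bar>"
  shows "7 / (64 * K) \<le> J" "J \<le> 2 * R"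
proof -
  define P where "P = (\<lambda>s. of_real a * \<nu> + of_real s * (\<i> * \<nu>))"
  define s1 s2 where "s1 = inner zp (\<i> * \<nu>)" and "s2 = inner zm (\<i> * \<nu>)"
  have s12: "s1 < s2" using less by (simp add: s1_def s2_def)
  have ends: "N (P s1) = 1" "N (P s2) = 1"
    using complex_eq_by_frame[OF \<nu>, of zp] complex_eq_by_frame[OF \<nu>, of zm] z
    by (simp_all add: P_def s1_def s2_def)
  have affine: "P ((1 - \<tau>) * s + \<tau> * t) = of_real (1 - \<tau>) * P s + of_real \<tau> * P t" for \<tau> s t
    by (simp add: P_def algebra_simps)
  have P_lip: "N (P s) \<le> N (P t) + K * \<bar>s - t\<bar>" for s t
  proof -
    have "P s - P t = of_real (s - t) * (\<i> * \<nu>)" by (simp add: P_def algebra_simps)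
    then have "cmod (P s - P t) = \<bar>s - t\<bar>"
      using \<nu> by (simp add: norm_mult del: of_real_diff)
    then show ?thesis using N_diff_le[of "P s" "P t"] by simp
  qed
  have K0: "K > 0" using K by simp
  have P0: "N (P 0) < 1 / 2"
  proof -
    have "N (P 0) \<le> K * a" using N_le[of "P 0"] \<nu> a by (simp add: P_def norm_mult)
    also have "\<dots> < 1 / 2" using a K0 by (simp add: field_simps)
    finally show ?thesis .
  qed
  \<comment> \<open>Points strictly between the foot and a boundary point are interior, so the two
    ends of the chord cannot lie on the same side of the foot.\<close>
  have mid: "N (P s) < 1" if "N (P t) = 1" "s = \<tau> * t" "0 < \<tau>" "\<tau> < 1" for s t \<tau>
  proof -
    have "P s = of_real (1 - \<tau>) * P 0 + of_real \<tau> * P t" using affine[of \<tau> 0 t] that by simp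
    then have "N (P s) \<le> (1 - \<tau>) * N (P 0) + \<tau> * 1" using N_convex[of \<tau> "P 0" "P t"] that by simp
    also have "(1 - \<tau>) * N (P 0) < (1 - \<tau>) * 1" using P0 that by (intro mult_strict_left_mono) auto
    finally show ?thesis by simp
  qed
  have "s1 \<le> 0"
  proof (rule ccontr)
    assume "\<not> s1 \<le> 0"
    then have "N (P s1) < 1" using s12 ends by (intro mid[of s2 s1 "s1 / s2"]) auto
    with ends show False by simp
  qed
  have "s2 \<ge> 0"
  proof (rule ccontr)
    assume "\<not> s2 \<ge> 0"
    then have "N (P s2) < 1" using s12 ends by (intro mid[of s1 s2 "s2 / s1"]) (auto simp: divide_simps)
    with ends show False by simp
  qed
  have "1 < 1 / 2 + K * s2" using P_lip[of s2 0] P0 ends \<open>s2 \<ge> 0\<close> by simp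
  then have "s2 > 1 / (2 * K)" using K0 by (simp add: field_simps)
  moreover have "1 / (4 * K) \<le> 1 / (2 * K)" using K0 by (simp add: field_simps)
  ultimately have sub: "{0..1 / (4 * K)} \<subseteq> {s1..s2}" using \<open>s1 \<le> 0\<close> by auto
  have F: "profile \<nu> a s = 1 - (N (P s))\<^sup>2" for s by (simp add: profile_def P_def)
  have nonneg: "profile \<nu> a s \<ge> 0" if s: "s \<in> {s1..s2}" for s
  proof -
    define \<tau> where "\<tau> = (s - s1) / (s2 - s1)"
    have \<tau>: "0 \<le> \<tau>" "\<tau> \<le> 1" using s s12 by (auto simp: \<tau>_def)
    have "\<tau> * (s2 - s1) = s - s1" using s12 by (simp add: \<tau>_def)
    then have "s = (1 - \<tau>) * s1 + \<tau> * s2" by (simp add: algebra_simps)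
    then have "N (P s) \<le> (1 - \<tau>) * 1 + \<tau> * 1"
      using N_convex[OF \<tau>, of "P s1" "P s2"] ends affine by simp
    then show ?thesis using N_nonneg[of "P s"] by (simp add: F power_le_one)
  qed
  have int: "profile \<nu> a integrable_on {s..t}" for s t
    by (intro integrable_continuous_real profile_continuous)
  have J: "J = integral {s1..s2} (profile \<nu> a)"
    unfolding J_def s1_def[symmetric] s2_def[symmetric]
    using nonneg by (intro abs_of_nonneg integral_nonneg int) auto
  \<comment> \<open>On this segment \<open>N \<le> 1 / 2 + 1 / 4\<close>, and
    \<open>1 - (3 / 4)\<^sup>2 = 7 / 16\<close>; the segment has length
    \<open>1 / (4 * K)\<close>.\<close>
  have "7 / (64 * K) = integral {0..1 / (4 * K)} (\<lambda>_. 7 / 16)" using K0 by simp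
  also have "\<dots> \<le> integral {0..1 / (4 * K)} (profile \<nu> a)"
  proof (rule integral_le[OF _ int])
    fix s assume s: "s \<in> {0..1 / (4 * K)}"
    then have "K * s \<le> 1 / 4" using K0 by (simp add: field_simps)
    then have "N (P s) \<le> 3 / 4" using P_lip[of s 0] P0 s by simp
    then have "(N (P s))\<^sup>2 \<le> (3 / 4)\<^sup>2" using N_nonneg by (intro power_mono) auto
    then show "7 / 16 \<le> profile \<nu> a s" by (simp add: F power2_eq_square)
  qed (rule integrable_const_ivl)
  also have "\<dots> \<le> integral {s1..s2} (profile \<nu> a)"
    using sub nonneg by (intro integral_subset_le int) auto
  finally show "7 / (64 * K) \<le> J" by (simp add: J)
  have "J \<le> integral {s1..s2} (\<lambda>_. 1)"
    unfolding J by (rule integral_le[OF int]) (auto simp: F)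
  also have "\<dots> = s2 - s1" using s12 by simp
  also have "\<dots> \<le> 2 * R"
    using Cauchy_Schwarz_ineq2[of zp "\<i> * \<nu>"] Cauchy_Schwarz_ineq2[of zm "\<i> * \<nu>"]
      N_ge[of zp] N_ge[of zm] z \<nu> by (simp add: s1_def s2_def norm_mult)
  finally show "J \<le> 2 * R" .
qed


lemma chord_integral_equiv_cap_area:
  obtains M where "M > 0"
    "\<And>\<nu> a \<alpha> \<beta> zp zm. \<lbrakk>cap \<nu> a \<alpha> \<beta>; {\<gamma> \<alpha>, \<gamma> \<beta>} = {zp, zm}; inner zp (\<i> * \<nu>) < inner zm (\<i> * \<nu>)\<rbrakk> \<Longrightarrow>
      cap_area \<nu> a \<alpha> \<beta> \<le> M * \<bar>integral {inner zp (\<i> * \<nu>)..inner zm (\<i> * \<nu>)} (profile \<nu> a)\<bar> \<and>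
      \<bar>integral {inner zp (\<i> * \<nu>)..inner zm (\<i> * \<nu>)} (profile \<nu> a)\<bar> \<le> M * cap_area \<nu> a \<alpha> \<beta>"
proof -
  \<comment> \<open>\<open>M1\<close> and \<open>M2\<close> serve chords with
    \<open>a \<ge> 1 / (2 * K)\<close>. For the others, \<open>M3\<close> and \<open>M4\<close> are
    an upper bound of one quantity divided by a lower bound of the other.\<close>
  define M1 M2 M3 M4 where "M1 = 2 * K\<^sup>2 * R ^ 3" and "M2 = 8 * R * K\<^sup>2"
    and "M3 = 2 * pi * R * (64 * K / 7)" and "M4 = 2 * R * (4 * K)\<^sup>2"
  have M: "M1 > 0" "M2 > 0" "M3 > 0" "M4 > 0" using K R by (auto simp: M1_def M2_def M3_def M4_def)
  define M where "M = M1 + M2 + M3 + M4"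
  have le: "x \<le> M * y" if "x \<le> k * y" "y \<ge> 0" "k \<in> {M1, M2, M3, M4}" for x y k
  proof -
    have "k \<le> M" using that(3) M by (auto simp: M_def)
    then have "k * y \<le> M * y" using that(2) by (rule mult_right_mono)
    with that(1) show ?thesis by linarith
  qed
  have "cap_area \<nu> a \<alpha> \<beta> \<le> M * J \<and> J \<le> M * cap_area \<nu> a \<alpha> \<beta>"
    if cap: "cap \<nu> a \<alpha> \<beta>" and z: "{\<gamma> \<alpha>, \<gamma> \<beta>} = {zp, zm}"
      and less: "inner zp (\<i> * \<nu>) < inner zm (\<i> * \<nu>)"
      and J: "J = \<bar>integral {inner zp (\<i> * \<nu>)..inner zm (\<i> * \<nu>)} (profile \<nu> a)\<bar>"
    for \<nu> a \<alpha> \<beta> zp zm J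
  proof -
    let ?A = "cap_area \<nu> a \<alpha> \<beta>"
    have A: "?A \<ge> 0" by (rule cap_area_nonneg[OF cap])
    have J0: "J \<ge> 0" by (simp add: J)
    show ?thesis
    proof (cases "a \<ge> 1 / (2 * K)")
      case True
      have "?A / M1 \<le> J" "J \<le> M2 * ?A"
        using chord_integral_far[OF cap True z less] by (simp_all add: J M1_def M2_def)
      then have "?A \<le> M1 * J" "J \<le> M2 * ?A" using M by (simp_all add: pos_divide_le_eq mult.commute)
      then show ?thesis using le[of ?A M1 J] le[of J M2 ?A] A J0 by simp
    next
      case False
      have ends: "N zp = 1" "N zm = 1" "inner zp \<nu> = a" "inner zm \<nu> = a"
        using z cap N_curve[of \<alpha>] N_curve[of \<beta>] by (auto simp: doubleton_eq_iff cap_def)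
      have \<nu>: "cmod \<nu> = 1" and a: "0 \<le> a" "a < 1 / (2 * K)" using cap False by (auto simp: cap_def)
      have Jb: "7 / (64 * K) \<le> J" "J \<le> 2 * R"
        using chord_integral_near[OF \<nu> a ends less] by (simp_all add: J)
      have Ab: "(1 / (4 * K))\<^sup>2 \<le> ?A" "?A \<le> 2 * pi * R"
        using cap_area_near[OF cap a(2)] by simp_all
      have "?A \<le> (2 * pi * R) * 1" using Ab by simp
      also have "\<dots> = M3 * (7 / (64 * K))" using K by (simp add: M3_def)
      also have "\<dots> \<le> M3 * J" using M Jb by (intro mult_left_mono) auto
      finally have 1: "?A \<le> M3 * J" .
      have "J \<le> (2 * R) * 1" using Jb by simp
      also have "\<dots> = M4 * (1 / (4 * K))\<^sup>2" using K by (simp add: M4_def power_divide)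
      also have "\<dots> \<le> M4 * ?A" using M Ab by (intro mult_left_mono) auto
      finally have "J \<le> M4 * ?A" .
      then show ?thesis using 1 le[of ?A M3 J] le[of J M4 ?A] A J0 by simp
    qed
  qed
  moreover have "M > 0" using M by (simp add: M_def)
  ultimately show ?thesis using that[of M] by blast
qed

lemma c1D_equiv_cENT:
  "\<exists>C>0. \<forall>zp zm. N zp = 1 \<longrightarrow> N zm = 1 \<longrightarrow> zp \<noteq> zm \<longrightarrow>
    c1D N zp zm / C \<le> cENT N \<gamma> zp zm \<and> cENT N \<gamma> zp zm \<le> C * c1D N zp zm"
proof -
  obtain M where M: "M > 0"
    "\<And>\<nu> a \<alpha> \<beta> zp zm. \<lbrakk>cap \<nu> a \<alpha> \<beta>; {\<gamma> \<alpha>, \<gamma> \<beta>} = {zp, zm}; inner zp (\<i> * \<nu>) < inner zm (\<i> * \<nu>)\<rbrakk> \<Longrightarrow>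
      cap_area \<nu> a \<alpha> \<beta> \<le> M * \<bar>integral {inner zp (\<i> * \<nu>)..inner zm (\<i> * \<nu>)} (profile \<nu> a)\<bar> \<and>
      \<bar>integral {inner zp (\<i> * \<nu>)..inner zm (\<i> * \<nu>)} (profile \<nu> a)\<bar> \<le> M * cap_area \<nu> a \<alpha> \<beta>"
    using chord_integral_equiv_cap_area by blast
  obtain C where C: "C > 0"
    "\<And>\<nu> a \<alpha> \<beta>. cap \<nu> a \<alpha> \<beta> \<Longrightarrow> cap_area \<nu> a \<alpha> \<beta> \<le> C * Sup (pairing \<nu> a \<alpha> \<beta> ` admissible)"
    using cap_area_le_Sup_pairing by blast
  \<comment> \<open>With \<open>A\<close> the cap area, \<open>J\<close> the chord integral and
    \<open>E\<close> the entropy cost: \<open>2 * J \<le> 2 * M * A \<le> 2 * M * C * E\<close> in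
    one direction, \<open>E \<le> A \<le> M * J\<close> in the other.\<close>
  define D where "D = 2 * M * C + M"
  have D: "D > 0" "2 * M * C \<le> D" "M \<le> D" using M C by (auto simp: D_def intro: add_pos_pos)
  have pos: "c1D N zp zm \<le> D * cENT N \<gamma> zp zm \<and> cENT N \<gamma> zp zm \<le> D * c1D N zp zm"
    if z: "N zp = 1" "N zm = 1" "zp \<noteq> zm" and a: "inner zp (nu_vec zp zm) \<ge> 0" for zp zm
  proof -
    define \<nu> where "\<nu> = nu_vec zp zm"
    define a where "a = inner zp \<nu>"
    obtain \<alpha> \<beta> where cap: "cap \<nu> a \<alpha> \<beta>" "{\<gamma> \<alpha>, \<gamma> \<beta>} = {zp, zm}"
      and ent: "cENT N \<gamma> zp zm = Sup (pairing \<nu> a \<alpha> \<beta> ` admissible)"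
      using cENT_eq_Sup[OF z \<nu>_def a_def[symmetric]] a unfolding a_def \<nu>_def by blast
    define J where "J = \<bar>integral {inner zp (\<i> * \<nu>)..inner zm (\<i> * \<nu>)} (profile \<nu> a)\<bar>"
    have c: "c1D N zp zm = 2 * J" unfolding J_def by (rule c1D_eq[OF z(3) \<nu>_def a_def])
    let ?A = "cap_area \<nu> a \<alpha> \<beta>" and ?E = "cENT N \<gamma> zp zm"
    have AJ: "?A \<le> M * J" "J \<le> M * ?A"
      using M(2)[OF cap] inner_nu_vec_less[OF z(3)] by (auto simp: J_def \<nu>_def)
    have AE: "?A \<le> C * ?E" "?E \<le> ?A"
      using C(2)[OF cap(1)] Sup_pairing_le_cap_area[OF cap(1)] by (simp_all add: ent)
    have "0 \<le> C * ?E" using AE(1) cap_area_nonneg[OF cap(1)] by linarith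
    then have E0: "?E \<ge> 0" using C(1) by (simp add: zero_le_mult_iff)
    have J0: "J \<ge> 0" by (simp add: J_def)
    have "c1D N zp zm \<le> 2 * (M * ?A)" using c AJ by simp
    also have "\<dots> \<le> 2 * (M * (C * ?E))" using M(1) AE by (intro mult_left_mono) auto
    also have "\<dots> = (2 * M * C) * ?E" by simp
    also have "\<dots> \<le> D * ?E" using D E0 by (intro mult_right_mono)
    finally have 1: "c1D N zp zm \<le> D * ?E" .
    have "?E \<le> M * J" using AE AJ by linarith
    also have "\<dots> \<le> D * J" using D J0 by (intro mult_right_mono)
    also have "\<dots> \<le> D * c1D N zp zm" using D J0 c by simp
    finally show ?thesis using 1 by blast
  qed
  have "c1D N zp zm / D \<le> cENT N \<gamma> zp zm \<and> cENT N \<gamma> zp zm \<le> D * c1D N zp zm"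
    if z: "N zp = 1" "N zm = 1" "zp \<noteq> zm" for zp zm
  proof -
    have "c1D N zp zm \<le> D * cENT N \<gamma> zp zm \<and> cENT N \<gamma> zp zm \<le> D * c1D N zp zm"
    proof (cases "inner zp (nu_vec zp zm) \<ge> 0")
      case True
      then show ?thesis using pos z by blast
    next
      case False
      then have "inner zm (nu_vec zm zp) \<ge> 0"
        by (simp add: nu_vec_swap[of zm zp] inner_nu_vec)
      then show ?thesis using pos[of zm zp] z by (simp add: c1D_swap[of N zm] cENT_swap[of N \<gamma> zm])
    qed
    then show ?thesis using D by (simp add: pos_divide_le_eq mult.commute)
  qed
  then show ?thesis using D by blast
qed

end

subsection \<open>Gradient of the norm\<close>

lemma derivative_le_lipschitz:
  fixes f :: "real \<Rightarrow> real"
  assumes "(f has_real_derivative D) (at x)" and lip: "\<And>y. \<bar>f y - f x\<bar> \<le> L * \<bar>y - x\<bar>"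
  shows "D \<le> L"
proof (rule tendsto_upperbound)
  show "((\<lambda>h. (f (x + h) - f x) / h) \<longlongrightarrow> D) (at 0)"
    using assms(1) by (simp add: DERIV_def)
  have "(f (x + h) - f x) / h \<le> L" if "h \<noteq> 0" for h
  proof -
    have "\<bar>(f (x + h) - f x) / h\<bar> \<le> L" using lip[of "x + h"] that by (simp add: abs_divide pos_divide_le_eq)
    then show ?thesis by linarith
  qed
  then show "\<forall>\<^sub>F h in at 0. (f (x + h) - f x) / h \<le> L"
    by (auto simp: eventually_at_filter)
qed simp

text \<open>Compactness of the Euclidean unit circle, on which \<open>N\<close> is continuous
  because it is differentiable there; homogeneity does the rest.\<close>

lemma norm_bounds:
  assumes N: "is_norm N" and C1: "C1_away_from_0 N"
  obtains K R where "K \<ge> 1" "R \<ge> 1" "\<And>x. N x \<le> K * cmod x" "\<And>x. cmod x \<le> R * N x"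
proof -
  have hom: "N (of_real c * x) = \<bar>c\<bar> * N x" for c x using N by (simp add: is_norm_def)
  have tri: "N (x + y) \<le> N x + N y" for x y using N by (simp add: is_norm_def)
  have zero: "N x = 0 \<longleftrightarrow> x = 0" for x using N by (simp add: is_norm_def)
  have nonneg: "N x \<ge> 0" for x
    using tri[of x "- x"] hom[of "-1" x] zero[of 0] by simp
  obtain g where g: "\<And>x. x \<noteq> 0 \<Longrightarrow> (N has_derivative (\<lambda>h. inner (g x) h)) (at x)"
    using C1 by (auto simp: C1_away_from_0_def)
  have cont: "continuous_on (sphere 0 1) N"
    by (intro continuous_at_imp_continuous_on ballI has_derivative_continuous[OF g]) auto
  have ne: "sphere (0 :: complex) 1 \<noteq> {}" by simp
  obtain u where u: "u \<in> sphere 0 1" "\<And>x. x \<in> sphere 0 1 \<Longrightarrow> N x \<le> N u"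
    using continuous_attains_sup[OF compact_sphere ne cont] by blast
  obtain v where v: "v \<in> sphere 0 1" "\<And>x. x \<in> sphere 0 1 \<Longrightarrow> N v \<le> N x"
    using continuous_attains_inf[OF compact_sphere ne cont] by blast
  have v0: "N v > 0" using nonneg[of v] zero[of v] v(1) by (auto simp: less_le)
  have polar: "N x = cmod x * N (x / of_real (cmod x))" "x / of_real (cmod x) \<in> sphere 0 1"
    if "x \<noteq> 0" for x
  proof -
    have "N (of_real (cmod x) * (x / of_real (cmod x))) = cmod x * N (x / of_real (cmod x))"
      unfolding hom by simp
    then show "N x = cmod x * N (x / of_real (cmod x))" using that by simp
    show "x / of_real (cmod x) \<in> sphere 0 1" using that by (simp add: norm_divide)
  qed
  show ?thesis
  proof (rule that[of "max 1 (N u)" "max 1 (1 / N v)"])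
    fix x
    show "N x \<le> max 1 (N u) * cmod x"
    proof (cases "x = 0")
      case False
      have "N x \<le> cmod x * max 1 (N u)"
        unfolding polar(1)[OF False] using u(2)[OF polar(2)[OF False]] by (intro mult_left_mono) auto
      then show ?thesis by (simp add: mult.commute)
    qed (use zero[of 0] in simp)
    show "cmod x \<le> max 1 (1 / N v) * N x"
    proof (cases "x = 0")
      case False
      have "cmod x * N v \<le> N x"
        unfolding polar(1)[OF False] using v(2)[OF polar(2)[OF False]] by (intro mult_left_mono) auto
      then have "cmod x \<le> (1 / N v) * N x" using v0 by (simp add: field_simps)
      also have "\<dots> \<le> max 1 (1 / N v) * N x" using nonneg by (intro mult_right_mono) auto
      finally show ?thesis .
    qed (use nonneg in simp)
  qed auto
qed

text \<open>The gradient of \<open>N\<close> at a point of the unit sphere has length at most \<open>K\<close> and inner product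
  \<open>1\<close> with the point (Euler's identity), and it is orthogonal to the velocity.\<close>

lemma det_ge:
  assumes N: "is_norm N" and C1: "C1_away_from_0 N" and K: "K \<ge> 1" "\<And>x. N x \<le> K * cmod x"
    and \<gamma>: "\<And>t. N (\<gamma> t) = 1" and v: "(\<gamma> has_vector_derivative v) (at t)" "cmod v = 1"
  shows "\<bar>Im (cnj (\<gamma> t) * v)\<bar> \<ge> 1 / K"
proof -
  have hom: "N (of_real c * x) = \<bar>c\<bar> * N x" for c x using N by (simp add: is_norm_def)
  have tri: "N (x + y) \<le> N x + N y" for x y using N by (simp add: is_norm_def)
  have zero: "N x = 0 \<longleftrightarrow> x = 0" for x using N by (simp add: is_norm_def)
  define u where "u = \<gamma> t"
  have Nu: "N u = 1" by (simp add: u_def \<gamma>)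
  have u0: "u \<noteq> 0" using Nu zero[of u] by auto
  obtain G where G: "(N has_derivative (\<lambda>h. inner G h)) (at u)"
    using C1 u0 by (auto simp: C1_away_from_0_def)
  have line: "((\<lambda>s. N (u + s *\<^sub>R w)) has_real_derivative inner G w) (at 0)" for w
  proof -
    have "((\<lambda>s. u + s *\<^sub>R w) has_derivative (\<lambda>s. s *\<^sub>R w)) (at 0)"
      by (auto intro!: derivative_eq_intros)
    moreover have "(N has_derivative (\<lambda>h. inner G h)) (at (u + 0 *\<^sub>R w))" using G by simp
    ultimately have "(N \<circ> (\<lambda>s. u + s *\<^sub>R w) has_derivative (\<lambda>h. inner G h) \<circ> (\<lambda>s. s *\<^sub>R w)) (at 0)"
      by (rule diff_chain_at)
    then show ?thesis by (simp add: has_field_derivative_def o_def mult_commute_abs)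
  qed
  \<comment> \<open>The derivative of \<open>N\<close> in direction \<open>G\<close> is the squared
    length of \<open>G\<close>, and it is bounded by the Lipschitz constant
    \<open>K * cmod G\<close> along that line.\<close>
  have "cmod G * cmod G \<le> K * cmod G"
  proof (rule derivative_le_lipschitz)
    show "((\<lambda>s. N (u + s *\<^sub>R G)) has_real_derivative cmod G * cmod G) (at 0)"
      using line[of G] by (simp add: dot_square_norm power2_eq_square)
    fix s :: real
    have "N (u + s *\<^sub>R G) - N u \<le> N (s *\<^sub>R G)" using tri[of u "s *\<^sub>R G"] by simp
    moreover have "N u - N (u + s *\<^sub>R G) \<le> N (- s *\<^sub>R G)" using tri[of "u + s *\<^sub>R G" "- s *\<^sub>R G"] by simp
    moreover have "N (s *\<^sub>R G) \<le> \<bar>s\<bar> * (K * cmod G)" "N (- s *\<^sub>R G) \<le> \<bar>s\<bar> * (K * cmod G)"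
      using hom[of s G] hom[of "- s" G] K(2)[of G] by (auto simp: scaleR_conv_of_real intro: mult_left_mono)
    ultimately show "\<bar>N (u + s *\<^sub>R G) - N (u + 0 *\<^sub>R G)\<bar> \<le> K * cmod G * \<bar>s - 0\<bar>"
      by (simp add: abs_le_iff mult_ac)
  qed
  then have GK: "cmod G \<le> K" using K(1) by (cases "cmod G = 0") auto
  \<comment> \<open>Euler's identity: along its own ray
    \<open>N (u + s u) = \<bar>1 + s\<bar>\<close>.\<close>
  have "((\<lambda>s. N (u + s *\<^sub>R u)) has_real_derivative 1) (at 0)"
  proof -
    have "N (u + s *\<^sub>R u) = \<bar>1 + s\<bar>" for s
      using hom[of "1 + s" u] Nu by (simp add: scaleR_conv_of_real algebra_simps)
    moreover have "((\<lambda>s :: real. \<bar>1 + s\<bar>) has_real_derivative 1) (at 0)"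
      by (rule has_field_derivative_transform_within_open[of "\<lambda>s. 1 + s" _ _ "{-1<..}"])
        (auto intro!: derivative_eq_intros)
    ultimately show ?thesis by simp
  qed
  then have Gu: "inner G u = 1" using line[of u] DERIV_unique by blast
  have "(N \<circ> \<gamma> has_derivative (\<lambda>h. inner G h) \<circ> (\<lambda>s. s *\<^sub>R v)) (at t)"
    using v(1) G unfolding has_vector_derivative_def u_def by (rule diff_chain_at)
  then have "((\<lambda>_. 1) has_real_derivative inner G v) (at t)"
    by (simp add: has_field_derivative_def o_def mult_commute_abs \<gamma>)
  then have Gv: "inner G v = 0" using DERIV_unique[OF _ DERIV_const] by blast
  \<comment> \<open>In the frame \<open>v\<close>, \<open>\<i> * v\<close> only the second component
    of \<open>G\<close> survives. The remaining factor \<open>inner u (\<i> * v)\<close> is the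
    determinant up to sign, so \<open>1\<close> is at most \<open>K\<close> times its absolute
    value.\<close>
  have "inner G u * 1 = inner G (\<i> * v) * inner u (\<i> * v)"
  proof -
    have "inner G u = inner G (of_real (inner u v) * v + of_real (inner u (\<i> * v)) * (\<i> * v))"
      using complex_eq_by_frame[OF v(2), of u] by simp
    also have "\<dots> = inner u v * inner G v + inner u (\<i> * v) * inner G (\<i> * v)"
      by (simp only: inner_add_right inner_scaleR_right flip: scaleR_conv_of_real)
    finally show ?thesis using Gv by simp
  qed
  then have "1 = \<bar>inner G (\<i> * v)\<bar> * \<bar>inner u (\<i> * v)\<bar>" using Gu by (simp flip: abs_mult)
  also have "\<dots> \<le> K * \<bar>inner u (\<i> * v)\<bar>"
    using Cauchy_Schwarz_ineq2[of G "\<i> * v"] GK v(2) by (intro mult_right_mono) (auto simp: norm_mult)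
  also have "\<bar>inner u (\<i> * v)\<bar> = \<bar>Im (cnj (\<gamma> t) * v)\<bar>"
    by (simp add: inner_complex_def u_def abs_minus_commute mult.commute)
  finally show ?thesis using K(1) by (simp add: pos_divide_le_eq mult.commute)
qed

theorem theorem1p11:
  fixes N :: "complex \<Rightarrow> real" and \<gamma> :: "real \<Rightarrow> complex"
  assumes "is_norm N" and "strictly_convex_norm N" and "C1_away_from_0 N"
    and "ccw_arclength_param N \<gamma>"
  shows "\<exists>C0 > 0. \<forall>zp zm. N zp = 1 \<longrightarrow> N zm = 1 \<longrightarrow> zp \<noteq> zm \<longrightarrow>
           c1D N zp zm / C0 \<le> cENT N \<gamma> zp zm \<and> cENT N \<gamma> zp zm \<le> C0 * c1D N zp zm"
proof -
  obtain K R where KR: "K \<ge> 1" "R \<ge> 1" "\<And>x. N x \<le> K * cmod x" "\<And>x. cmod x \<le> R * N x"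
    using norm_bounds[OF assms(1,3)] by blast
  have \<gamma>: "range \<gamma> = {z. N z = 1}" and d: "\<And>t. \<gamma> differentiable (at t)"
    and s: "\<And>t. cmod (vector_derivative \<gamma> (at t)) = 1"
    using assms(4) by (auto simp: ccw_arclength_param_def)
  have deriv: "(\<gamma> has_vector_derivative vector_derivative \<gamma> (at t)) (at t)" for t
    using d vector_derivative_works by blast
  have N\<gamma>: "N (\<gamma> t) = 1" for t using \<gamma> by blast
  interpret strictly_convex_curve N \<gamma> "\<lambda>t. vector_derivative \<gamma> (at t)" K R
  proof
    show "\<bar>Im (cnj (\<gamma> t) * vector_derivative \<gamma> (at t))\<bar> \<ge> 1 / K" for t
      by (rule det_ge[OF assms(1,3) KR(1,3) N\<gamma> deriv s])
  qed (use assms KR \<gamma> deriv s in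
      \<open>auto simp: is_norm_def strictly_convex_norm_def ccw_arclength_param_def\<close>)
  show ?thesis by (rule c1D_equiv_cENT)
qed

end
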